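(* Let $c\ge0$ and $\theta\in[0,\infty)^2$, and let $X^{c,\theta}$ be the infinite rate mutually catalytic branching process with parameters $(c,\theta)$. The point $0\in E$ is polar for $X^{c,\theta}$, that is, for all $x\in E$, $$\mathbf{P}_x\big[X^{c,\theta}_t=0\text{ for some }t>0\big]=0.$$
   Context: Let $E:=[0,\infty)^2\setminus(0,\infty)^2$. For $x\in[0,\infty)^2$, let $B$ be a standard planar Brownian motion started at $x$, let $\tau=\inf\{t>0: B_t\notin(0,\infty)^2\}$, and let $Q_x$ be the law of $B_\tau$ (a probability measure on $E$; $Q_x=\delta_x$ if $x\in E$). For $c\ge0$, $\theta\in[0,\infty)^2$, $t\ge0$ and $x\in E$ let $p_t(x,\cdot):=Q_{e^{-ct}x+(1-e^{-ct})\theta}$. The infinite rate mutually catalytic branching process $X^{c,\theta}$ with parameters $(c,\theta)$ is the Markov process with state space $E$, càdlàg paths and transition kernels $(p_t)_{t\ge0}$; $\mathbf{P}_x$ is its law when started at $x$. A measurable set $A\subset E$ is called polar for $X^{c,\theta}$ if $\mathbf{P}_x[X^{c,\theta}_t\in A\text{ for some }t>0]=0$ for all $x\in E$; a point is polar if the corresponding singleton is polar.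
   Formalization: The starting point x = 0 is excluded when c = 0 or θ = 0, since the process started at 0 then stays at 0 and hits 0 with probability 1; polarity of 0 is stated for c > 0 and θ ≠ 0, and for all c, θ the probability is zero for every x ≠ 0 in E. *)

theory Defs
  imports "HOL-Probability.Probability"
begin

definition closed_quadrant :: "(real \<times> real) set" where
  "closed_quadrant = {0..} \<times> {0..}"

definition open_quadrant :: "(real \<times> real) set" where
  "open_quadrant = {0<..} \<times> {0<..}"

definition axes_E :: "(real \<times> real) set" where
  "axes_E = closed_quadrant - open_quadrant"

definition planar_brownian_motion ::
  "'v measure \<Rightarrow> (real \<Rightarrow> 'v \<Rightarrow> real \<times> real) \<Rightarrow> real \<times> real \<Rightarrow> bool" where
  "planar_brownian_motion M B x \<longleftrightarrow>
     prob_space M \<and>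
     (\<forall>t\<ge>0. B t \<in> borel_measurable M) \<and>
     (\<forall>\<omega>\<in>space M. B 0 \<omega> = x \<and> continuous_on {0..} (\<lambda>t. B t \<omega>)) \<and>
     (\<forall>(r :: nat \<Rightarrow> real) n. 0 \<le> r 0 \<and> incseq r \<longrightarrow>
        prob_space.indep_vars M (\<lambda>_. borel) (\<lambda>i \<omega>. B (r (Suc i)) \<omega> - B (r i) \<omega>) {..<n}) \<and>
     (\<forall>s t. 0 \<le> s \<and> s < t \<longrightarrow>
        distributed M lborel (\<lambda>\<omega>. B t \<omega> - B s \<omega>)
          (\<lambda>(u, v). ennreal (normal_density 0 (sqrt (t - s)) u * normal_density 0 (sqrt (t - s)) v)))"

text \<open>
  The exit time is almost surely finite; on the null event where the path never leaves the open
  quadrant, the infimum of the empty set is an unspecified real constant, which does not affect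
  the law below.
\<close>
definition exit_time :: "(real \<Rightarrow> 'v \<Rightarrow> real \<times> real) \<Rightarrow> 'v \<Rightarrow> real" where
  "exit_time B \<omega> = Inf {t. t > 0 \<and> B t \<omega> \<notin> open_quadrant}"

text \<open>
  For a Brownian motion \<open>B\<close> on \<open>M\<close> started at \<open>x\<close> this is the measure \<open>Q\<^sub>x\<close>, regarded as a Borel
  measure on the plane that is carried by \<^const>\<open>axes_E\<close>.
\<close>
definition exit_law :: "'v measure \<Rightarrow> (real \<Rightarrow> 'v \<Rightarrow> real \<times> real) \<Rightarrow> (real \<times> real) measure" where
  "exit_law M B = distr M borel (\<lambda>\<omega>. B (exit_time B \<omega>) \<omega>)"

definition imcb_kernel ::
  "(real \<times> real \<Rightarrow> (real \<times> real) measure) \<Rightarrow> real \<Rightarrow> real \<times> real \<Rightarrow>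
   real \<Rightarrow> real \<times> real \<Rightarrow> (real \<times> real) measure" where
  "imcb_kernel Q c \<theta> t x = Q (exp (- (c * t)) *\<^sub>R x + (1 - exp (- (c * t))) *\<^sub>R \<theta>)"

definition natural_filtration ::
  "'w measure \<Rightarrow> (real \<Rightarrow> 'w \<Rightarrow> real \<times> real) \<Rightarrow> real \<Rightarrow> 'w measure" where
  "natural_filtration M X s =
     sigma (space M) {X u -` A \<inter> space M | u A. 0 \<le> u \<and> u \<le> s \<and> A \<in> sets borel}"

definition cadlag :: "(real \<Rightarrow> real \<times> real) \<Rightarrow> bool" where
  "cadlag f \<longleftrightarrow>
     (\<forall>t\<ge>0. (f \<longlongrightarrow> f t) (at_right t)) \<and> (\<forall>t>0. \<exists>l. (f \<longlongrightarrow> l) (at_left t))"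

definition cadlag_markov_process ::
  "(real \<times> real) set \<Rightarrow> (real \<Rightarrow> real \<times> real \<Rightarrow> (real \<times> real) measure) \<Rightarrow> real \<times> real \<Rightarrow>
   'w measure \<Rightarrow> (real \<Rightarrow> 'w \<Rightarrow> real \<times> real) \<Rightarrow> bool" where
  "cadlag_markov_process S p x M X \<longleftrightarrow>
     prob_space M \<and>
     (\<forall>t\<ge>0. X t \<in> borel_measurable M) \<and>
     (\<forall>\<omega>\<in>space M. (\<forall>t\<ge>0. X t \<omega> \<in> S) \<and> cadlag (\<lambda>t. X t \<omega>)) \<and>
     (AE \<omega> in M. X 0 \<omega> = x) \<and>
     (\<forall>s\<ge>0. \<forall>t\<ge>0. \<forall>A\<in>sets borel.
        AE \<omega> in M. real_cond_exp M (natural_filtration M X s)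
                      (\<lambda>\<omega>'. indicator A (X (s + t) \<omega>')) \<omega> = measure (p t (X s \<omega>)) A)"

text \<open>\<open>P x\<close> is the probability measure under which the process \<open>X\<close> starts at \<open>x\<close>.\<close>
definition imcb_process ::
  "(real \<times> real \<Rightarrow> (real \<times> real) measure) \<Rightarrow> real \<Rightarrow> real \<times> real \<Rightarrow>
   (real \<times> real \<Rightarrow> 'w measure) \<Rightarrow> (real \<Rightarrow> 'w \<Rightarrow> real \<times> real) \<Rightarrow> bool" where
  "imcb_process Q c \<theta> P X \<longleftrightarrow>
     (\<forall>x\<in>axes_E. cadlag_markov_process axes_E (imcb_kernel Q c \<theta>) x (P x) X)"

text \<open>
  The event that \<open>X\<close> visits \<open>A\<close> is an uncountable union and need not belong to the given
  sigma-algebra, so "probability zero" means that it is contained in a measurable null set.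
\<close>
definition never_hits ::
  "'w measure \<Rightarrow> (real \<Rightarrow> 'w \<Rightarrow> real \<times> real) \<Rightarrow> (real \<times> real) set \<Rightarrow> bool" where
  "never_hits M X A \<longleftrightarrow> (AE \<omega> in M. \<not> (\<exists>t>0. X t \<omega> \<in> A))"

definition polar ::
  "(real \<times> real \<Rightarrow> 'w measure) \<Rightarrow> (real \<Rightarrow> 'w \<Rightarrow> real \<times> real) \<Rightarrow> (real \<times> real) set \<Rightarrow> bool" where
  "polar P X A \<longleftrightarrow> A \<in> sets borel \<and> A \<subseteq> axes_E \<and> (\<forall>x\<in>axes_E. never_hits (P x) X A)"

text \<open>
  If \<open>c = 0\<close> or \<open>\<theta> = 0\<close>, then \<open>imcb_kernel Q c \<theta> t 0 = Q 0\<close> is the point mass at \<open>0\<close>: the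
  process started at \<open>0\<close> stays there, and \<open>{0}\<close> is not polar. In these parameter cases only the
  starting points \<open>x \<noteq> 0\<close> can be considered.
\<close>

end

theory Submission
  imports Defs
begin

text \<open>
  The proof is a Lyapunov function argument. In the plane \<open>- ln |z|\<close> is superharmonic with a pole
  at the origin, and \<open>z\<^sub>1 + z\<^sub>2\<close> is harmonic. Their sum \<open>f z = z\<^sub>1 + z\<^sub>2 - ln |z|\<close> is nonnegative on
  the closed quadrant, because there \<open>|z| \<le> z\<^sub>1 + z\<^sub>2\<close>, and it is infinite exactly at the origin.
  Superharmonicity gives \<open>\<integral> f dQ\<^sub>x \<le> f x\<close> (lemma \<open>exit_law_log_potential\<close>). The deterministic motion
  towards \<open>\<theta>\<close> that precedes the exit law cannot push a point towards the origin faster than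
  exponentially (\<open>log_potential_drift\<close>), so \<open>\<integral> f dp\<^sub>t(y) \<le> f y + K t\<close> for some constant \<open>K\<close>. Hence
  \<open>f (X\<^sub>t)\<close> is, up to a linear drift, a nonnegative supermartingale, and the maximal inequality
  (\<open>markov_maximal_inequality\<close>) shows that it stays bounded on compact time intervals that start at
  a positive time \<open>s\<close>: unless the process starts at the origin with \<open>c = 0\<close> or \<open>\<theta> = 0\<close>, the law of
  \<open>X\<^sub>s\<close> is the exit law from a point other than the origin, so \<open>f (X\<^sub>s)\<close> has finite mean. By right-continuity the process cannot visit the pole of \<open>f\<close>
  (\<open>imcb_never_hits_zero_after\<close>).

  All integrals are taken of the regularised functions
  \<open>log_potential e z = z\<^sub>1 + z\<^sub>2 - ln (|z|\<^sup>2 + e) / 2\<close>, which are real-valued and continuous; the pole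
  reappears only at the very end, when \<open>e\<close> tends to 0 and the value at the origin grows without bound.

  The inequality for the exit law is derived directly from independent Gaussian increments.
  Adding \<open>\<delta> |z|\<^sup>2\<close> and a constant gives a function that is nonnegative on the whole plane and whose
  mean grows by at most \<open>2 \<delta> h + O(h\<^sup>3\<^sup>/\<^sup>2)\<close> under a Gaussian step of variance \<open>h\<close>
  (\<open>lyapunov_gaussian_step\<close>). Summing along a dyadic time grid up to the first grid time after the
  exit, refining the grid, and letting \<open>\<delta>\<close> tend to 0 bounds the mean of the potential at the minimum
  of the exit time and a horizon \<open>N\<close> (\<open>stopped_log_potential\<close>). The same bound shows that the exit time is
  almost surely finite (\<open>AE_exits\<close>), and \<open>N\<close> can be sent to infinity.
\<close>

section \<open>The regularised logarithmic potential\<close>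

text \<open>
  For nonnegative arguments the second-order Taylor polynomial is a lower bound, because the
  difference has derivative \<open>x\<^sup>2 / (1 + x) \<ge> 0\<close>. For negative arguments a cubic error that blows
  up at \<open>-1\<close> has to be allowed.
\<close>
lemma ln_one_plus_ge_quadratic:
  fixes y :: real
  assumes "0 \<le> y"
  shows "y - y\<^sup>2 / 2 \<le> ln (1 + y)"
proof -
  let ?f = "\<lambda>y::real. ln (1 + y) - y + y\<^sup>2 / 2"
  have "?f 0 \<le> ?f y"
  proof (rule DERIV_nonneg_imp_nondecreasing[OF assms])
    fix x :: real assume x: "0 \<le> x" "x \<le> y"
    have "(?f has_real_derivative (x\<^sup>2 / (1 + x))) (at x)"
      using x by (auto intro!: derivative_eq_intros simp: field_simps power2_eq_square)
    then show "\<exists>d. (?f has_real_derivative d) (at x) \<and> 0 \<le> d"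
      using x by (intro exI[of _ "x\<^sup>2 / (1 + x)"]) auto
  qed
  then show ?thesis by simp
qed

lemma ln_one_minus_ge_cubic:
  fixes w :: real
  assumes "0 \<le> w" "w < 1"
  shows "- w - w\<^sup>2 / 2 - w ^ 3 / (1 - w) \<le> ln (1 - w)"
proof -
  let ?f = "\<lambda>w::real. ln (1 - w) + w + w\<^sup>2 / 2 + w ^ 3 / (1 - w)"
  have "?f 0 \<le> ?f w"
  proof (rule DERIV_nonneg_imp_nondecreasing[OF assms(1)])
    fix x :: real assume "0 \<le> x" "x \<le> w"
    then have x: "0 \<le> x" "x < 1" using assms by auto
    have "(?f has_real_derivative
        (- 1 / (1 - x) + 1 + x + (3 * x\<^sup>2 * (1 - x) + x ^ 3) / (1 - x)\<^sup>2)) (at x)"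
      using x by (auto intro!: derivative_eq_intros simp: power2_eq_square)
    also have "- 1 / (1 - x) + 1 + x + (3 * x\<^sup>2 * (1 - x) + x ^ 3) / (1 - x)\<^sup>2
        = x\<^sup>2 * (2 - x) / (1 - x)\<^sup>2"
      using x by (simp add: divide_simps) (simp add: algebra_simps power2_eq_square power3_eq_cube)
    finally have "(?f has_real_derivative (x\<^sup>2 * (2 - x) / (1 - x)\<^sup>2)) (at x)" .
    then show "\<exists>d. (?f has_real_derivative d) (at x) \<and> 0 \<le> d"
      using x by (intro exI[of _ "x\<^sup>2 * (2 - x) / (1 - x)\<^sup>2"]) auto
  qed
  then show ?thesis by simp
qed

text \<open>
  A second-order expansion of \<open>ln (|z + g|\<^sup>2 + e)\<close> whose error is uniform in \<open>z\<close>. With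
  \<open>a = |z|\<^sup>2 + e\<close> the logarithm is \<open>ln a + ln (1 + y)\<close>, where \<open>y = (2 z \<bullet> g + |g|\<^sup>2) / a\<close>.
  The dangerous case is \<open>y\<close> close to \<open>-1\<close>; but \<open>1 + y \<ge> e / a\<close>, and \<open>|y| \<le> 2 |z| |g| / a\<close> for
  negative \<open>y\<close>, so the cubic error is still controlled by \<open>|g|\<^sup>3\<close> alone. The parameter \<open>\<eta>\<close> trades \<open>|g|\<^sup>3\<close> for
  \<open>|g|\<^sup>2\<close> and \<open>|g|\<^sup>4\<close>, so that the error becomes a polynomial with explicit Gaussian mean; for
  increments of variance \<open>h\<close> the good choice is \<open>\<eta> = sqrt h\<close>.
\<close>
lemma ln_regularised_norm_ge:
  fixes z g :: "'a::real_inner" and e \<eta> :: real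
  assumes e: "0 < e" and \<eta>: "0 < \<eta>" "\<eta> \<le> 1"
  defines "a \<equiv> (norm z)\<^sup>2 + e"
  shows "ln a + (2 * (z \<bullet> g) + (norm g)\<^sup>2) / a - 2 * (z \<bullet> g)\<^sup>2 / a\<^sup>2
           - (5 / e + 6 / e\<^sup>2) * (\<eta> * (norm g)\<^sup>2 + (norm g) ^ 4 / \<eta>)
         \<le> ln ((norm (z + g))\<^sup>2 + e)"
proof -
  define r where "r = norm z"
  define \<rho> where "\<rho> = norm g"
  define p where "p = z \<bullet> g"
  define y where "y = (2 * p + \<rho>\<^sup>2) / a"
  have r: "0 \<le> r" and \<rho>: "0 \<le> \<rho>" by (auto simp: r_def \<rho>_def)
  have p: "\<bar>p\<bar> \<le> r * \<rho>" unfolding p_def r_def \<rho>_def by (rule Cauchy_Schwarz_ineq2)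
  have a_def': "a = r\<^sup>2 + e" by (simp add: a_def r_def)
  have a: "0 < a" "e \<le> a" "r\<^sup>2 \<le> a" using e by (auto simp: a_def' add_nonneg_pos)
  have ng: "(norm (z + g))\<^sup>2 = r\<^sup>2 + 2 * p + \<rho>\<^sup>2"
    by (simp add: power2_norm_eq_inner r_def \<rho>_def p_def inner_add inner_commute)
  have ay: "(norm (z + g))\<^sup>2 + e = a * (1 + y)"
  proof -
    have "a * y = 2 * p + \<rho>\<^sup>2" using a unfolding y_def by simp
    then have "a * (1 + y) = a + (2 * p + \<rho>\<^sup>2)" by (simp only: distrib_left mult_1_right)
    then show ?thesis by (simp add: ng a_def')
  qed
  have "a * (1 + y) \<ge> e" using ay zero_le_power2[of "norm (z + g)"] by linarith
  then have y1: "1 + y \<ge> e / a" using a by (simp add: field_simps)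
  have y1p: "1 + y > 0" using y1 e a by (meson divide_pos_pos less_le_trans)
  have eq: "ln ((norm (z + g))\<^sup>2 + e) = ln a + ln (1 + y)"
    using a y1p by (simp add: ay ln_mult)
  \<comment> \<open>Young's inequality turns the odd powers of the increment into even ones.\<close>
  have young: "2 * (s * t) \<le> \<eta> * s\<^sup>2 + t\<^sup>2 / \<eta>" for s t :: real
  proof -
    have "0 \<le> (\<eta> * s - t)\<^sup>2 / \<eta>" using \<eta> by simp
    also have "\<dots> = \<eta> * s\<^sup>2 + t\<^sup>2 / \<eta> - 2 * (s * t)"
      using \<eta> by (simp add: field_simps power2_eq_square)
    finally show ?thesis by simp
  qed
  have q1: "r\<^sup>2 / a\<^sup>2 \<le> 1 / e"
  proof -
    have "r\<^sup>2 / a\<^sup>2 \<le> a / a\<^sup>2" using a by (intro divide_right_mono) auto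
    also have "\<dots> = 1 / a" using a by (simp add: power2_eq_square)
    also have "\<dots> \<le> 1 / e" using a e by (simp add: frac_le)
    finally show ?thesis .
  qed
  have q2: "r ^ 4 / a\<^sup>2 \<le> 1"
  proof -
    have "r ^ 4 = (r\<^sup>2)\<^sup>2" by simp
    also have "\<dots> \<le> a\<^sup>2" using a by (intro power_mono) auto
    finally show ?thesis using a by simp
  qed
  have q3: "1 / a\<^sup>2 \<le> 1 / e\<^sup>2" using a e by (intro frac_le power_mono) auto
  have quad: "y\<^sup>2 / 2 \<le> 2 * p\<^sup>2 / a\<^sup>2 + (\<eta> * \<rho>\<^sup>2 / e + \<rho> ^ 4 / \<eta> / e\<^sup>2) + \<rho> ^ 4 / \<eta> / (2 * e\<^sup>2)"
  proof -
    have "y\<^sup>2 / 2 = 2 * p\<^sup>2 / a\<^sup>2 + 2 * p * \<rho>\<^sup>2 / a\<^sup>2 + \<rho> ^ 4 / (2 * a\<^sup>2)"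
      using a by (simp add: y_def power_divide field_simps power2_eq_square power4_eq_xxxx)
    moreover have "2 * p * \<rho>\<^sup>2 / a\<^sup>2 \<le> \<eta> * \<rho>\<^sup>2 / e + \<rho> ^ 4 / \<eta> / e\<^sup>2"
    proof -
      have "2 * p * \<rho>\<^sup>2 \<le> 2 * (r * \<rho>) * \<rho>\<^sup>2"
        using p by (intro mult_right_mono mult_left_mono) auto
      also have "\<dots> = 2 * ((r * \<rho>) * \<rho>\<^sup>2)" by simp
      also have "\<dots> \<le> \<eta> * (r * \<rho>)\<^sup>2 + (\<rho>\<^sup>2)\<^sup>2 / \<eta>" by (rule young)
      also have "\<dots> = (\<eta> * \<rho>\<^sup>2) * r\<^sup>2 + \<rho> ^ 4 / \<eta>" by (simp add: power_mult_distrib)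
      finally have "2 * p * \<rho>\<^sup>2 / a\<^sup>2 \<le> ((\<eta> * \<rho>\<^sup>2) * r\<^sup>2 + \<rho> ^ 4 / \<eta>) / a\<^sup>2"
        by (intro divide_right_mono) auto
      also have "\<dots> = (\<eta> * \<rho>\<^sup>2) * (r\<^sup>2 / a\<^sup>2) + (\<rho> ^ 4 / \<eta>) * (1 / a\<^sup>2)"
        by (simp add: add_divide_distrib)
      also have "\<dots> \<le> (\<eta> * \<rho>\<^sup>2) * (1 / e) + (\<rho> ^ 4 / \<eta>) * (1 / e\<^sup>2)"
        using q1 q3 \<eta> \<rho> by (intro add_mono mult_left_mono) auto
      finally show ?thesis by simp
    qed
    moreover have "\<rho> ^ 4 / (2 * a\<^sup>2) \<le> \<rho> ^ 4 / \<eta> / (2 * e\<^sup>2)"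
    proof -
      have "\<rho> ^ 4 \<le> \<rho> ^ 4 / \<eta>" using \<eta> \<rho> by (simp add: le_divide_eq mult_left_le)
      then have "\<rho> ^ 4 * (1 / a\<^sup>2) \<le> \<rho> ^ 4 / \<eta> * (1 / e\<^sup>2)"
        using q3 \<rho> \<eta> by (intro mult_mono) auto
      then show ?thesis by simp
    qed
    ultimately show ?thesis by linarith
  qed
  have cubic: "y - y\<^sup>2 / 2 - 4 * (\<eta> * \<rho>\<^sup>2 + \<rho> ^ 4 / \<eta> / e) / e \<le> ln (1 + y)"
  proof (cases "0 \<le> y")
    case True
    have "0 \<le> 4 * (\<eta> * \<rho>\<^sup>2 + \<rho> ^ 4 / \<eta> / e) / e" using e \<eta> by auto
    then show ?thesis using ln_one_plus_ge_quadratic[OF True] by linarith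
  next
    case False
    define w where "w = - y"
    have w: "0 \<le> w" "w < 1" using False y1p by (auto simp: w_def)
    have "w * a = - 2 * p - \<rho>\<^sup>2" using a by (simp add: w_def y_def)
    also have "\<dots> \<le> 2 * (r * \<rho>)" using p zero_le_power2[of \<rho>] by linarith
    finally have "w \<le> 2 * (r * \<rho>) / a" using a by (simp add: field_simps)
    then have "w ^ 3 \<le> (2 * (r * \<rho>) / a) ^ 3" using w by (intro power_mono) auto
    then have "w ^ 3 / (1 - w) \<le> (2 * (r * \<rho>) / a) ^ 3 / (e / a)"
      using y1 w r \<rho> a e by (intro frac_le) (auto simp: w_def)
    also have "\<dots> = 4 * (2 * ((r\<^sup>2 * \<rho>) * (r * \<rho>\<^sup>2))) / a\<^sup>2 / e"
      using a e by (simp add: field_simps power2_eq_square power3_eq_cube)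
    also have "\<dots> \<le> 4 * (\<eta> * (r\<^sup>2 * \<rho>)\<^sup>2 + (r * \<rho>\<^sup>2)\<^sup>2 / \<eta>) / a\<^sup>2 / e"
      using young[of "r\<^sup>2 * \<rho>" "r * \<rho>\<^sup>2"] e a by (intro divide_right_mono mult_left_mono) auto
    also have "\<dots> = 4 * ((\<eta> * \<rho>\<^sup>2) * (r ^ 4 / a\<^sup>2) + (\<rho> ^ 4 / \<eta>) * (r\<^sup>2 / a\<^sup>2)) / e"
      by (simp add: power_mult_distrib add_divide_distrib ring_distribs mult_ac flip: power_mult)
    also have "\<dots> \<le> 4 * ((\<eta> * \<rho>\<^sup>2) * 1 + (\<rho> ^ 4 / \<eta>) * (1 / e)) / e"
      using q1 q2 \<eta> \<rho> e by (intro divide_right_mono mult_left_mono add_mono) auto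
    finally have "w ^ 3 / (1 - w) \<le> 4 * (\<eta> * \<rho>\<^sup>2 + \<rho> ^ 4 / \<eta> / e) / e" by simp
    then show ?thesis using ln_one_minus_ge_cubic[OF w] by (simp add: w_def)
  qed
  have A: "0 \<le> \<rho> ^ 4 / \<eta> / e\<^sup>2" "0 \<le> \<rho> ^ 4 / \<eta> / e" "0 \<le> \<eta> * \<rho>\<^sup>2 / e\<^sup>2" using \<eta> e by auto
  have split1: "4 * (\<eta> * \<rho>\<^sup>2 + \<rho> ^ 4 / \<eta> / e) / e = 4 * (\<eta> * \<rho>\<^sup>2 / e) + 4 * (\<rho> ^ 4 / \<eta> / e\<^sup>2)"
    using e by (simp add: field_simps power2_eq_square)
  have split2: "\<rho> ^ 4 / \<eta> / (2 * e\<^sup>2) = (\<rho> ^ 4 / \<eta> / e\<^sup>2) / 2" by simp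
  have split3: "(5 / e + 6 / e\<^sup>2) * (\<eta> * \<rho>\<^sup>2 + \<rho> ^ 4 / \<eta>)
      = 5 * (\<eta> * \<rho>\<^sup>2 / e) + 5 * (\<rho> ^ 4 / \<eta> / e) + 6 * (\<eta> * \<rho>\<^sup>2 / e\<^sup>2) + 6 * (\<rho> ^ 4 / \<eta> / e\<^sup>2)"
    by (simp add: algebra_simps)
  have "y - 2 * p\<^sup>2 / a\<^sup>2 - (5 / e + 6 / e\<^sup>2) * (\<eta> * \<rho>\<^sup>2 + \<rho> ^ 4 / \<eta>) \<le> ln (1 + y)"
  proof -
    have "y - P - (5 * A' + 5 * C + 6 * D + 6 * B) \<le> L"
      if "y - Q - (4 * A' + 4 * B) \<le> L" "Q \<le> P + (A' + B) + B / 2" "0 \<le> B" "0 \<le> C" "0 \<le> D"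
      for A' B C D P Q L :: real using that by linarith
    from this[OF cubic[unfolded split1] quad[unfolded split2] A] show ?thesis unfolding split3 .
  qed
  then show ?thesis unfolding eq by (simp add: y_def p_def \<rho>_def)
qed

text \<open>
  As \<open>e\<close> tends to 0 this increases to \<open>z\<^sub>1 + z\<^sub>2 - ln |z|\<close>, the sum of a harmonic function and
  the logarithmic potential of the origin. For \<open>e > 0\<close> it is smooth, superharmonic, and equal to
  \<open>- ln e / 2\<close> at the origin.
\<close>
definition log_potential :: "real \<Rightarrow> real \<times> real \<Rightarrow> real" where
  "log_potential e z = fst z + snd z - ln ((norm z)\<^sup>2 + e) / 2"

lemma continuous_on_log_potential:
  assumes "0 < e"
  shows "continuous_on UNIV (log_potential e)"
proof -
  have "(norm z)\<^sup>2 + e \<noteq> 0" for z :: "real \<times> real"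
    using assms zero_le_power2[of "norm z"] by linarith
  then show ?thesis unfolding log_potential_def by (intro continuous_intros) auto
qed

lemma borel_measurable_log_potential [measurable]:
  "log_potential e \<in> borel_measurable borel"
proof -
  have [measurable]: "(fst :: real \<times> real \<Rightarrow> real) \<in> borel_measurable borel"
    "(snd :: real \<times> real \<Rightarrow> real) \<in> borel_measurable borel"
    by (intro borel_measurable_continuous_onI continuous_intros)+
  show ?thesis unfolding log_potential_def by measurable
qed

lemma half_ln_square_le:
  fixes r e :: real
  assumes "0 \<le> r" "0 < e" "e \<le> 1"
  shows "ln (r\<^sup>2 + e) / 2 \<le> ln (1 + r)"
proof -
  have "r\<^sup>2 + e \<le> (1 + r)\<^sup>2" using assms by (simp add: power2_sum)
  then have "ln (r\<^sup>2 + e) \<le> ln ((1 + r)\<^sup>2)"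
    using assms by (subst ln_le_cancel_iff) (auto simp: add_nonneg_pos)
  also have "\<dots> = 2 * ln (1 + r)" using assms by (simp add: ln_realpow)
  finally show ?thesis by simp
qed

lemma norm_le_sum_quadrant:
  fixes z :: "real \<times> real"
  assumes "z \<in> closed_quadrant"
  shows "norm z \<le> fst z + snd z"
  using assms sqrt_sum_squares_le_sum[of "fst z" "snd z"]
  by (auto simp: closed_quadrant_def norm_prod_def)

text \<open>
  On the quadrant \<open>|z| \<le> z\<^sub>1 + z\<^sub>2 = s\<close>, so the logarithm is at most \<open>ln (1 + s)\<close> and loses against
  \<open>s\<close>. That is why the harmonic function \<open>z\<^sub>1 + z\<^sub>2\<close> is included. The second bound, in which half
  of the linear part survives, later shows that Brownian motion leaves the quadrant.
\<close>
lemma log_potential_quadrant: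
  assumes "0 < e" "e \<le> 1" "z \<in> closed_quadrant"
  shows "0 \<le> log_potential e z" and "fst z / 2 \<le> log_potential e z + 1"
proof -
  have f: "0 \<le> fst z" "0 \<le> snd z" using assms by (auto simp: closed_quadrant_def)
  define s where "s = fst z + snd z"
  have s: "0 \<le> s" "norm z \<le> s" using norm_le_sum_quadrant[OF assms(3)] f by (auto simp: s_def)
  have "ln (1 + norm z) \<le> ln (1 + s)" using s by (subst ln_le_cancel_iff) (auto simp: add_pos_nonneg)
  then have l: "ln ((norm z)\<^sup>2 + e) / 2 \<le> ln (1 + s)"
    using half_ln_square_le[of "norm z" e] assms by simp
  show "0 \<le> log_potential e z"
    using l ln_add_one_self_le_self[of s] s by (simp add: log_potential_def s_def)
  \<comment> \<open>The tangent of the logarithm at 2.\<close>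
  have "1 + s = 2 * (1 + (s - 1) / 2)" by (simp add: field_simps)
  then have "ln (1 + s) = ln (2 * (1 + (s - 1) / 2))" by (rule arg_cong)
  also have "ln (2 * (1 + (s - 1) / 2)) = ln 2 + ln (1 + (s - 1) / 2)" using s by (intro ln_mult_pos) (auto simp: field_simps add_nonneg_pos)
  also have "\<dots> \<le> 1 + (s - 1) / 2"
    using s ln_2_less_1 ln_add_one_self_le_self2[of "(s - 1) / 2"] by (intro add_mono) auto
  finally show "fst z / 2 \<le> log_potential e z + 1"
    using l f by (simp add: log_potential_def s_def field_simps)
qed

lemma log_potential_lower_bound:
  assumes "0 < e" "e \<le> 1" "0 < \<delta>"
  shows "0 \<le> log_potential e z + \<delta> * (norm z)\<^sup>2 + 9 / (4 * \<delta>)"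
proof -
  let ?r = "norm z"
  have "\<bar>fst z\<bar> \<le> ?r" "\<bar>snd z\<bar> \<le> ?r"
    using norm_fst_le[of "fst z" "snd z"] norm_snd_le[of "snd z" "fst z"] by auto
  moreover have "ln (?r\<^sup>2 + e) / 2 \<le> ?r"
    using half_ln_square_le[of ?r e] ln_add_one_self_le_self[of ?r] assms by simp
  \<comment> \<open>The linear and logarithmic parts are at least \<open>-3 |z|\<close>; complete the square.\<close>
  moreover have "0 \<le> (2 * \<delta> * ?r - 3)\<^sup>2 / (4 * \<delta>)" using assms by simp
  moreover have "(2 * \<delta> * ?r - 3)\<^sup>2 / (4 * \<delta>) = \<delta> * ?r\<^sup>2 - 3 * ?r + 9 / (4 * \<delta>)"
    using assms by (simp add: field_simps power2_eq_square)
  ultimately show ?thesis unfolding log_potential_def by linarith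
qed

section \<open>Gaussian averages\<close>

text \<open>
  The expectation of a product of functions of independent coordinates; it supplies the mixed
  moments of the planar Gaussian law.
\<close>
lemma (in pair_sigma_finite) has_bochner_integral_times:
  fixes f g :: "_ \<Rightarrow> real"
  assumes "has_bochner_integral M1 f a" "has_bochner_integral M2 g b"
  shows "has_bochner_integral (M1 \<Otimes>\<^sub>M M2) (\<lambda>z. f (fst z) * g (snd z)) (a * b)"
proof -
  have i: "integrable M1 f" "integrable M2 g" and v: "integral\<^sup>L M1 f = a" "integral\<^sup>L M2 g = b"
    using assms by (auto simp: has_bochner_integral_iff)
  have [measurable]: "f \<in> borel_measurable M1" "g \<in> borel_measurable M2"
    using i by auto
  have int: "integrable (M1 \<Otimes>\<^sub>M M2) (\<lambda>z. f (fst z) * g (snd z))"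
  proof (rule Fubini_integrable)
    show "integrable M1 (\<lambda>x. \<integral> y. norm (f (fst (x, y)) * g (snd (x, y))) \<partial>M2)"
      using i by (simp add: abs_mult)
    show "AE x in M1. integrable M2 (\<lambda>y. f (fst (x, y)) * g (snd (x, y)))"
      using i by simp
  qed measurable
  moreover have "integral\<^sup>L (M1 \<Otimes>\<^sub>M M2) (\<lambda>z. f (fst z) * g (snd z)) = a * b"
    using integral_fst'[OF int] by (simp add: v)
  ultimately show ?thesis by (simp add: has_bochner_integral_iff)
qed

definition gaussian_density2 :: "real \<Rightarrow> real \<times> real \<Rightarrow> real" where
  "gaussian_density2 h z = normal_density 0 (sqrt h) (fst z) * normal_density 0 (sqrt h) (snd z)"

definition gaussian2 :: "real \<Rightarrow> (real \<times> real) measure" where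
  "gaussian2 h = density lborel (\<lambda>z. ennreal (gaussian_density2 h z))"

lemma gaussian_density2_nonneg: "0 \<le> gaussian_density2 h z"
  by (simp add: gaussian_density2_def)

lemma borel_measurable_gaussian_density2 [measurable]:
  "gaussian_density2 h \<in> borel_measurable borel"
proof -
  have [measurable]: "(fst :: real \<times> real \<Rightarrow> real) \<in> borel_measurable borel"
    "(snd :: real \<times> real \<Rightarrow> real) \<in> borel_measurable borel"
    by (intro borel_measurable_continuous_onI continuous_intros)+
  show ?thesis unfolding gaussian_density2_def by measurable
qed

lemma gaussian_density2_moment:
  assumes "has_bochner_integral lborel (\<lambda>u. normal_density 0 (sqrt h) u * u ^ i) a"
    and "has_bochner_integral lborel (\<lambda>u. normal_density 0 (sqrt h) u * u ^ j) b"
  shows "has_bochner_integral lborel (\<lambda>z. gaussian_density2 h z * (fst z ^ i * snd z ^ j)) (a * b)"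
  using lborel_pair.has_bochner_integral_times[OF assms]
  by (simp add: gaussian_density2_def lborel_prod mult_ac)

lemma normal_moments:
  fixes h :: real
  assumes "0 < h"
  shows "has_bochner_integral lborel (\<lambda>u. normal_density 0 (sqrt h) u * u ^ 0) 1"
    and "has_bochner_integral lborel (\<lambda>u. normal_density 0 (sqrt h) u * u ^ 1) 0"
    and "has_bochner_integral lborel (\<lambda>u. normal_density 0 (sqrt h) u * u ^ 2) h"
    and "has_bochner_integral lborel (\<lambda>u. normal_density 0 (sqrt h) u * u ^ 4) (3 * h\<^sup>2)"
proof -
  have s: "0 < sqrt h" using assms by simp
  show "has_bochner_integral lborel (\<lambda>u. normal_density 0 (sqrt h) u * u ^ 0) 1"
    using normal_moment_even[OF s, of 0 0] by simp
  show "has_bochner_integral lborel (\<lambda>u. normal_density 0 (sqrt h) u * u ^ 1) 0"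
    using normal_moment_odd[OF s, of 0 0] by simp
  show "has_bochner_integral lborel (\<lambda>u. normal_density 0 (sqrt h) u * u ^ 2) h"
    using normal_moment_even[OF s, of 0 1] assms by (simp add: fact_2)
  show "has_bochner_integral lborel (\<lambda>u. normal_density 0 (sqrt h) u * u ^ 4) (3 * h\<^sup>2)"
    using normal_moment_even[OF s, of 0 2] assms
    by (simp add: fact_numeral power2_eq_square)
qed

text \<open>
  To bound the Gaussian mean of a nonnegative function it suffices to dominate the function by a
  polynomial: odd moments vanish, each coordinate has second moment \<open>h\<close>, and the mean of
  \<open>|g|\<^sup>4 = u\<^sup>4 + 2 u\<^sup>2 v\<^sup>2 + v\<^sup>4\<close> is \<open>8 h\<^sup>2\<close>.
\<close>
lemma gaussian_step_polynomial:
  fixes h c0 b1 b2 q11 q12 q22 k :: real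
  assumes h: "0 < h"
    and nonneg: "\<And>g. 0 \<le> F g"
    and le: "\<And>u v. F (u, v) \<le> c0 + b1 * u + b2 * v + q11 * u\<^sup>2 + q12 * (u * v) + q22 * v\<^sup>2
      + k * (u ^ 4 + 2 * (u\<^sup>2 * v\<^sup>2) + v ^ 4)"
  shows "(\<integral>\<^sup>+g. ennreal (F g) \<partial>gaussian2 h) \<le> ennreal (c0 + (q11 + q22) * h + 8 * k * h\<^sup>2)"
proof -
  note N = normal_moments[OF h]
  note m = gaussian_density2_moment[OF N(1) N(1)] gaussian_density2_moment[OF N(2) N(1)]
    gaussian_density2_moment[OF N(1) N(2)] gaussian_density2_moment[OF N(3) N(1)]
    gaussian_density2_moment[OF N(2) N(2)] gaussian_density2_moment[OF N(1) N(3)]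
    gaussian_density2_moment[OF N(4) N(1)] gaussian_density2_moment[OF N(3) N(3)]
    gaussian_density2_moment[OF N(1) N(4)]
  let ?w = "gaussian_density2 h"
  let ?U = "\<lambda>g. c0 + b1 * fst g + b2 * snd g + q11 * (fst g)\<^sup>2 + q12 * (fst g * snd g)
    + q22 * (snd g)\<^sup>2 + k * (fst g ^ 4 + 2 * ((fst g)\<^sup>2 * (snd g)\<^sup>2) + snd g ^ 4)"
  note add = has_bochner_integral_add and mult = has_bochner_integral_mult_right
  have "has_bochner_integral lborel
     (\<lambda>g. c0 * (?w g * (fst g ^ 0 * snd g ^ 0)) + b1 * (?w g * (fst g ^ 1 * snd g ^ 0))
        + b2 * (?w g * (fst g ^ 0 * snd g ^ 1)) + q11 * (?w g * (fst g ^ 2 * snd g ^ 0))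
        + q12 * (?w g * (fst g ^ 1 * snd g ^ 1)) + q22 * (?w g * (fst g ^ 0 * snd g ^ 2))
        + k * (?w g * (fst g ^ 4 * snd g ^ 0)) + (2 * k) * (?w g * (fst g ^ 2 * snd g ^ 2))
        + k * (?w g * (fst g ^ 0 * snd g ^ 4)))
     (c0 * (1 * 1) + b1 * (0 * 1) + b2 * (1 * 0) + q11 * (h * 1) + q12 * (0 * 0) + q22 * (1 * h)
        + k * (3 * h\<^sup>2 * 1) + (2 * k) * (h * h) + k * (1 * (3 * h\<^sup>2)))"
    by (intro add mult m)
  then have U: "has_bochner_integral lborel (\<lambda>g. ?w g * ?U g) (c0 + (q11 + q22) * h + 8 * k * h\<^sup>2)"
    by (simp add: algebra_simps power2_eq_square)
  have FU: "F g \<le> ?U g" for g using le[of "fst g" "snd g"] by simp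
  have "(\<integral>\<^sup>+g. ennreal (F g) \<partial>gaussian2 h) \<le> (\<integral>\<^sup>+g. ennreal (?U g) \<partial>gaussian2 h)"
    using FU by (intro nn_integral_mono ennreal_leI)
  also have "\<dots> = (\<integral>\<^sup>+g. ennreal (?w g) * ennreal (?U g) \<partial>lborel)"
  proof -
    have [measurable]: "(fst :: real \<times> real \<Rightarrow> real) \<in> borel_measurable borel"
      "(snd :: real \<times> real \<Rightarrow> real) \<in> borel_measurable borel"
      by (intro borel_measurable_continuous_onI continuous_intros)+
    show ?thesis unfolding gaussian2_def by (rule nn_integral_density) measurable
  qed
  also have "\<dots> = (\<integral>\<^sup>+g. ennreal (?w g * ?U g) \<partial>lborel)"
    by (simp add: ennreal_mult' gaussian_density2_nonneg)
  also have "\<dots> = ennreal (c0 + (q11 + q22) * h + 8 * k * h\<^sup>2)"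
  proof (subst nn_integral_eq_integral)
    show "AE g in lborel. 0 \<le> ?w g * ?U g"
      using gaussian_density2_nonneg FU nonneg by (intro AE_I2 mult_nonneg_nonneg) (meson order_trans)+
  qed (use U in \<open>auto simp: has_bochner_integral_iff\<close>)
  finally show ?thesis .
qed

text \<open>
  A small multiple of \<open>|z|\<^sup>2\<close> and a constant make the potential nonnegative on the whole plane.
  This matters because a walk observed only at grid times may overshoot the quadrant, and outside
  the quadrant \<open>log_potential\<close> is unbounded below. A positive superharmonic function on the plane is
  constant, so some drift is the price; it is of size \<open>\<delta>\<close>.
\<close>
definition lyapunov :: "real \<Rightarrow> real \<Rightarrow> real \<times> real \<Rightarrow> real" where
  "lyapunov e \<delta> z = log_potential e z + \<delta> * (norm z)\<^sup>2 + 9 / (4 * \<delta>)"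

text \<open>
  The Laplacian of \<open>- ln (|z|\<^sup>2 + e) / 2\<close> is \<open>- 2 e / (|z|\<^sup>2 + e)\<^sup>2 \<le> 0\<close>. In the expansion this appears
  as \<open>|z|\<^sup>2 / a\<^sup>2 - 1 / a = - e / a\<^sup>2\<close>, so only the quadratic term contributes a drift of order \<open>h\<close>
  and the Taylor error is of order \<open>h\<^sup>3\<^sup>/\<^sup>2\<close>. Over a fixed time span there are about \<open>1 / h\<close> steps, so
  the accumulated error vanishes as the grid is refined.
\<close>
lemma lyapunov_gaussian_step:
  assumes e: "0 < e" "e \<le> 1" and \<delta>: "0 < \<delta>" and h: "0 < h" "h \<le> 1"
  shows "(\<integral>\<^sup>+g. ennreal (lyapunov e \<delta> (z + g)) \<partial>gaussian2 h)
     \<le> ennreal (lyapunov e \<delta> z + 2 * \<delta> * h + 5 * (5 / e + 6 / e\<^sup>2) * (h * sqrt h))"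
proof -
  define a where "a = (norm z)\<^sup>2 + e"
  define \<eta> where "\<eta> = sqrt h"
  define K where "K = 5 / e + 6 / e\<^sup>2"
  obtain x y where z: "z = (x, y)" by (cases z)
  have a: "0 < a" "a = x\<^sup>2 + y\<^sup>2 + e"
    using e by (auto simp: a_def z norm_prod_def add_nonneg_pos)
  have \<eta>: "0 < \<eta>" "\<eta> \<le> 1" "\<eta> * \<eta> = h" using h by (auto simp: \<eta>_def)
  have le: "lyapunov e \<delta> (z + (u, v)) \<le> lyapunov e \<delta> z + (1 - x / a + 2 * \<delta> * x) * u
        + (1 - y / a + 2 * \<delta> * y) * v
        + (\<delta> - 1 / (2 * a) + x\<^sup>2 / a\<^sup>2 + K * \<eta> / 2) * u\<^sup>2 + (2 * x * y / a\<^sup>2) * (u * v)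
        + (\<delta> - 1 / (2 * a) + y\<^sup>2 / a\<^sup>2 + K * \<eta> / 2) * v\<^sup>2
        + (K / (2 * \<eta>)) * (u ^ 4 + 2 * (u\<^sup>2 * v\<^sup>2) + v ^ 4)" (is "_ \<le> ?R") for u v
  proof -
    have ip: "z \<bullet> (u, v) = x * u + y * v" by (simp add: z)
    have ng: "(norm (u, v))\<^sup>2 = u\<^sup>2 + v\<^sup>2" by (simp add: norm_prod_def)
    then have ng4: "norm (u, v) ^ 4 = (u\<^sup>2 + v\<^sup>2)\<^sup>2"
      by (metis numeral_Bit0 power2_eq_square power_add)
    have nz: "(norm z)\<^sup>2 = x\<^sup>2 + y\<^sup>2" "(norm (z + (u, v)))\<^sup>2 = (x + u)\<^sup>2 + (y + v)\<^sup>2"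
      by (auto simp: z norm_prod_def)
    define l where "l = ln a + (2 * (x * u + y * v) + (u\<^sup>2 + v\<^sup>2)) / a - 2 * (x * u + y * v)\<^sup>2 / a\<^sup>2
           - K * (\<eta> * (u\<^sup>2 + v\<^sup>2) + (u\<^sup>2 + v\<^sup>2)\<^sup>2 / \<eta>)"
    have "l \<le> ln ((x + u)\<^sup>2 + (y + v)\<^sup>2 + e)"
      using ln_regularised_norm_ge[OF e(1) \<eta>(1,2), of z "(u, v)"]
      unfolding ip ng ng4 nz l_def K_def a(2) .
    then have "lyapunov e \<delta> (z + (u, v)) \<le> (x + u) + (y + v) - l / 2
        + \<delta> * ((x + u)\<^sup>2 + (y + v)\<^sup>2) + 9 / (4 * \<delta>)"
      unfolding lyapunov_def log_potential_def nz by (simp add: z)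
    also have "\<dots> = ?R"
      unfolding lyapunov_def log_potential_def nz a(2)[symmetric] l_def using a(1) \<eta>(1)
      by (simp add: z) (simp add: field_simps power2_eq_square power4_eq_xxxx)
    finally show ?thesis .
  qed
  have "(\<integral>\<^sup>+g. ennreal (lyapunov e \<delta> (z + g)) \<partial>gaussian2 h)
     \<le> ennreal (lyapunov e \<delta> z + ((\<delta> - 1 / (2 * a) + x\<^sup>2 / a\<^sup>2 + K * \<eta> / 2)
        + (\<delta> - 1 / (2 * a) + y\<^sup>2 / a\<^sup>2 + K * \<eta> / 2)) * h + 8 * (K / (2 * \<eta>)) * h\<^sup>2)"
    using gaussian_step_polynomial[OF h(1) _ le] log_potential_lower_bound[OF e \<delta>]
    by (simp add: lyapunov_def)
  also have "\<dots> \<le> ennreal (lyapunov e \<delta> z + 2 * \<delta> * h + 5 * K * (h * sqrt h))"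
  proof (rule ennreal_leI)
    have 1: "h\<^sup>2 / \<eta> = h * \<eta>" using \<eta> by (simp add: field_simps power2_eq_square flip: \<eta>(3))
    have 2: "x\<^sup>2 / a\<^sup>2 + y\<^sup>2 / a\<^sup>2 - 1 / a = - e / a\<^sup>2"
    proof -
      have "x\<^sup>2 / a\<^sup>2 + y\<^sup>2 / a\<^sup>2 = (a - e) / a\<^sup>2"
        using a(2) by (simp flip: add_divide_distrib)
      then show ?thesis using a(1) by (simp add: diff_divide_distrib power2_eq_square)
    qed
    have "((\<delta> - 1 / (2 * a) + x\<^sup>2 / a\<^sup>2 + K * \<eta> / 2)
        + (\<delta> - 1 / (2 * a) + y\<^sup>2 / a\<^sup>2 + K * \<eta> / 2)) * h + 8 * (K / (2 * \<eta>)) * h\<^sup>2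
      = 2 * \<delta> * h + (x\<^sup>2 / a\<^sup>2 + y\<^sup>2 / a\<^sup>2 - 1 / a) * h + K * \<eta> * h + 4 * K * (h\<^sup>2 / \<eta>)"
      by (simp add: algebra_simps)
    also have "\<dots> = 2 * \<delta> * h + (- e / a\<^sup>2) * h + 5 * K * (h * \<eta>)"
      unfolding 1 2 by simp
    also have "\<dots> \<le> 2 * \<delta> * h + 5 * K * (h * \<eta>)"
      using e h by simp
    finally show "lyapunov e \<delta> z + ((\<delta> - 1 / (2 * a) + x\<^sup>2 / a\<^sup>2 + K * \<eta> / 2)
        + (\<delta> - 1 / (2 * a) + y\<^sup>2 / a\<^sup>2 + K * \<eta> / 2)) * h + 8 * (K / (2 * \<eta>)) * h\<^sup>2
      \<le> lyapunov e \<delta> z + 2 * \<delta> * h + 5 * K * (h * sqrt h)" unfolding \<eta>_def by linarith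
  qed
  finally show ?thesis unfolding K_def .
qed

section \<open>Brownian increments are independent of the past\<close>

text \<open>
  \<open>dyadic_right a l / 2 ^ l\<close> is the first dyadic number of level \<open>l\<close> strictly to the right of \<open>a\<close>.
\<close>
definition dyadic_right :: "real \<Rightarrow> nat \<Rightarrow> nat" where
  "dyadic_right a l = Suc (nat \<lfloor>a * 2 ^ l\<rfloor>)"

lemma dyadic_right_bounds:
  assumes "0 \<le> a"
  shows "a < dyadic_right a l / 2 ^ l" "dyadic_right a l / 2 ^ l \<le> a + 1 / 2 ^ l"
proof -
  have "real (nat \<lfloor>a * 2 ^ l\<rfloor>) = of_int \<lfloor>a * 2 ^ l\<rfloor>" using assms by simp
  then have "a * 2 ^ l < dyadic_right a l" "dyadic_right a l \<le> a * 2 ^ l + 1"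
    unfolding dyadic_right_def by linarith+
  then show "a < dyadic_right a l / 2 ^ l" "dyadic_right a l / 2 ^ l \<le> a + 1 / 2 ^ l"
    by (auto simp: field_simps)
qed

lemma inverse_two_power_tendsto: "(\<lambda>l. 1 / 2 ^ l :: real) \<longlonglongrightarrow> 0"
  using LIMSEQ_power_zero[of "1 / 2 :: real"] by (simp add: power_one_over)

lemma dyadic_right_tendsto:
  assumes "0 \<le> a"
  shows "(\<lambda>l. real (dyadic_right a l) / 2 ^ l) \<longlonglongrightarrow> a"
proof (rule tendsto_sandwich[of "\<lambda>_. a" _ _ "\<lambda>l. a + 1 / 2 ^ l"])
  show "(\<lambda>l. a + 1 / 2 ^ l) \<longlonglongrightarrow> a"
    using tendsto_add[OF tendsto_const inverse_two_power_tendsto, of a] by simp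
qed (use dyadic_right_bounds[OF assms] in \<open>auto intro!: always_eventually less_imp_le\<close>)

locale planar_brownian = prob_space M
  for M :: "'v measure" and B :: "real \<Rightarrow> 'v \<Rightarrow> real \<times> real" and x :: "real \<times> real" +
  assumes bm: "planar_brownian_motion M B x"
begin

lemma B_measurable [measurable]: "0 \<le> t \<Longrightarrow> B t \<in> borel_measurable M"
  using bm by (simp add: planar_brownian_motion_def)

lemma B_start: "\<omega> \<in> space M \<Longrightarrow> B 0 \<omega> = x"
  using bm by (simp add: planar_brownian_motion_def)

lemma B_continuous: "\<omega> \<in> space M \<Longrightarrow> continuous_on {0..} (\<lambda>t. B t \<omega>)"
  using bm by (simp add: planar_brownian_motion_def)

lemma B_tendsto:
  assumes "\<omega> \<in> space M" "0 \<le> t" "\<And>n. 0 \<le> s n" "s \<longlonglongrightarrow> t"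
  shows "(\<lambda>n. B (s n) \<omega>) \<longlonglongrightarrow> B t \<omega>"
  using continuous_on_tendsto_compose[OF B_continuous[OF assms(1)] assms(4)] assms(2,3) by simp

lemma B_increment_distr:
  assumes "0 \<le> t" "0 < h"
  shows "distr M borel (\<lambda>\<omega>. B (t + h) \<omega> - B t \<omega>) = gaussian2 h"
proof -
  have "\<forall>s t. 0 \<le> s \<and> s < t \<longrightarrow> distributed M lborel (\<lambda>\<omega>. B t \<omega> - B s \<omega>)
          (\<lambda>(u, v). ennreal (normal_density 0 (sqrt (t - s)) u * normal_density 0 (sqrt (t - s)) v))"
    using bm unfolding planar_brownian_motion_def by blast
  from this[rule_format, of t "t + h"] have "distributed M lborel (\<lambda>\<omega>. B (t + h) \<omega> - B t \<omega>)
      (\<lambda>z. ennreal (gaussian_density2 h z))"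
    using assms by (simp add: gaussian_density2_def case_prod_beta')
  then have "distr M lborel (\<lambda>\<omega>. B (t + h) \<omega> - B t \<omega>) = gaussian2 h"
    unfolding distributed_def gaussian2_def by simp
  moreover have "distr M lborel (\<lambda>\<omega>. B (t + h) \<omega> - B t \<omega>) = distr M borel (\<lambda>\<omega>. B (t + h) \<omega> - B t \<omega>)"
    by (rule distr_cong) auto
  ultimately show ?thesis by simp
qed

text \<open>
  The history up to time \<open>t\<close> is recorded along the dyadic subdivisions of the interval from 0 to
  \<open>t\<close>. These grids are nested, so the events they generate form an increasing union and hence a
  \<open>\<pi>\<close>-system; path continuity makes them rich enough to decide whether the path has left the quadrant
  before time \<open>t\<close>.
\<close>
definition grid_path :: "real \<Rightarrow> nat \<Rightarrow> 'v \<Rightarrow> nat \<Rightarrow> real \<times> real" where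
  "grid_path t m \<omega> = (\<lambda>i\<in>{..2 ^ m}. B (t * (real i / 2 ^ m)) \<omega>)"

abbreviation grid_space :: "nat \<Rightarrow> (nat \<Rightarrow> real \<times> real) measure" where
  "grid_space m \<equiv> PiM {..2 ^ m} (\<lambda>_. borel)"

definition grid_events :: "real \<Rightarrow> nat \<Rightarrow> 'v set set" where
  "grid_events t m = {grid_path t m -` A \<inter> space M | A. A \<in> sets (grid_space m)}"

definition past :: "real \<Rightarrow> 'v measure" where
  "past t = sigma (space M) (\<Union>m. grid_events t m)"

lemma grid_path_measurable [measurable]:
  assumes "0 \<le> t"
  shows "grid_path t m \<in> measurable M (grid_space m)"
  unfolding grid_path_def using assms by (intro measurable_restrict B_measurable) auto

text \<open>
  A grid path is a function of the increments along the grid, and the increment after \<open>t\<close> is one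
  further member of the same independent family.
\<close>
lemma grid_path_indep:
  assumes t: "0 \<le> t" and h: "0 \<le> h"
    and A: "A \<in> sets (grid_space m)" and C: "C \<in> sets borel"
  shows "prob ((grid_path t m -` A \<inter> space M) \<inter> ((\<lambda>\<omega>. B (t + h) \<omega> - B t \<omega>) -` C \<inter> space M))
    = prob (grid_path t m -` A \<inter> space M) * prob ((\<lambda>\<omega>. B (t + h) \<omega> - B t \<omega>) -` C \<inter> space M)"
proof -
  \<comment> \<open>The increment with index \<open>2 ^ m\<close> is the one from \<open>t\<close> to \<open>t + h\<close>.\<close>
  define r where "r i = (if i \<le> 2 ^ m then t * (i / 2 ^ m) else t + h)" for i :: nat
  define D where "D i \<omega> = B (r (Suc i)) \<omega> - B (r i) \<omega>" for i \<omega>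
  have "\<forall>(r :: nat \<Rightarrow> real) n. 0 \<le> r 0 \<and> incseq r \<longrightarrow>
        indep_vars (\<lambda>_. borel) (\<lambda>i \<omega>. B (r (Suc i)) \<omega> - B (r i) \<omega>) {..<n}"
    using bm unfolding planar_brownian_motion_def by blast
  moreover have "incseq r"
  proof (rule incseq_SucI)
    fix i
    have "t * (real i / 2 ^ m) \<le> t * 1" if "i \<le> 2 ^ m"
      using that t by (intro mult_left_mono) (auto simp: divide_le_eq)
    moreover have "t * (real i / 2 ^ m) \<le> t * (real (Suc i) / 2 ^ m)"
      using t by (intro mult_left_mono divide_right_mono) auto
    ultimately show "r i \<le> r (Suc i)" using t h by (auto simp: r_def)
  qed
  moreover have "0 \<le> r 0" by (simp add: r_def)
  ultimately have "indep_vars (\<lambda>_. borel) D {..<Suc (2 ^ m)}" unfolding D_def by blast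
  then have "indep_var (PiM {..<2 ^ m} (\<lambda>_. borel)) (\<lambda>\<omega>. restrict (\<lambda>i. D i \<omega>) {..<2 ^ m})
      (PiM {2 ^ m} (\<lambda>_. borel)) (\<lambda>\<omega>. restrict (\<lambda>i. D i \<omega>) {2 ^ m})"
    by (rule indep_var_restrict) auto
  note ind = this
  define Y where "Y v = (\<lambda>i\<in>{..2 ^ m}. x + (\<Sum>j<i. v j))" for v :: "nat \<Rightarrow> real \<times> real"
  have [measurable]: "Y \<in> measurable (PiM {..<2 ^ m} (\<lambda>_. borel)) (grid_space m)"
    unfolding Y_def by (intro measurable_restrict borel_measurable_add borel_measurable_sum
      measurable_component_singleton) auto
  have A': "Y -` A \<inter> space (PiM {..<2 ^ m} (\<lambda>_. borel)) \<in> sets (PiM {..<2 ^ m} (\<lambda>_. borel))"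
    using A by measurable
  have C': "(\<lambda>v. v (2 ^ m)) -` C \<inter> space (PiM {2 ^ m} (\<lambda>_. borel))
      \<in> sets (PiM {2 ^ m} (\<lambda>_. borel :: (real \<times> real) measure))"
    by (rule measurable_sets[OF _ C]) (rule measurable_component_singleton, simp)
  have path: "Y (restrict (\<lambda>i. D i \<omega>) {..<2 ^ m}) = grid_path t m \<omega>" if \<omega>: "\<omega> \<in> space M" for \<omega>
  proof -
    have "(\<Sum>j<i. D j \<omega>) = B (r i) \<omega> - x" for i
    proof -
      have "(\<Sum>j<i. D j \<omega>) = B (r i) \<omega> - B (r 0) \<omega>"
        unfolding D_def by (rule sum_lessThan_telescope)
      then show ?thesis using B_start[OF \<omega>] by (simp add: r_def)
    qed
    moreover have "(\<Sum>j<i. restrict (\<lambda>i. D i \<omega>) {..<2 ^ m} j) = (\<Sum>j<i. D j \<omega>)" if "i \<le> 2 ^ m" for i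
      using that by (intro sum.cong) auto
    ultimately show ?thesis by (auto simp: Y_def grid_path_def r_def fun_eq_iff restrict_def)
  qed
  have last: "D (2 ^ m) \<omega> = B (t + h) \<omega> - B t \<omega>" for \<omega> by (simp add: D_def r_def)
  from indep_varD[OF ind A' C'] show ?thesis
    by (rule back_subst[of "\<lambda>E. E"])
       (intro arg_cong2[of _ _ _ _ "(=)"] arg_cong2[of _ _ _ _ "(*)"] arg_cong[of _ _ prob];
        auto simp: path last space_PiM)
qed

lemma grid_events_mono:
  assumes "0 \<le> t" "m \<le> n"
  shows "grid_events t m \<subseteq> grid_events t n"
proof
  fix E assume "E \<in> grid_events t m"
  then obtain A where A: "A \<in> sets (grid_space m)" "E = grid_path t m -` A \<inter> space M"
    by (auto simp: grid_events_def)
  \<comment> \<open>The coarse path reads the fine path at every \<open>2 ^ (n - m)\<close>-th grid point.\<close>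
  define \<rho> :: "(nat \<Rightarrow> real \<times> real) \<Rightarrow> nat \<Rightarrow> real \<times> real"
    where "\<rho> v = (\<lambda>i\<in>{..2 ^ m}. v (i * 2 ^ (n - m)))" for v
  have le: "i * 2 ^ (n - m) \<le> (2 ^ n :: nat)" if "i \<le> 2 ^ m" for i
    using mult_right_mono[OF that, of "2 ^ (n - m)"] assms by (simp flip: power_add)
  have [measurable]: "\<rho> \<in> measurable (grid_space n) (grid_space m)"
    unfolding \<rho>_def by (intro measurable_restrict measurable_component_singleton) (use le in auto)
  have two: "(2::real) ^ n = 2 ^ m * 2 ^ (n - m)" using assms by (simp flip: power_add)
  have "grid_path t m \<omega> = \<rho> (grid_path t n \<omega>)" for \<omega>
    using le by (auto simp: grid_path_def \<rho>_def restrict_def fun_eq_iff two)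
  then have "E = grid_path t n -` (\<rho> -` A \<inter> space (grid_space n)) \<inter> space M"
    using measurable_space[OF grid_path_measurable[OF assms(1), of n]] by (auto simp: A)
  moreover have "\<rho> -` A \<inter> space (grid_space n) \<in> sets (grid_space n)"
    using A by measurable
  ultimately show "E \<in> grid_events t n" unfolding grid_events_def by blast
qed

lemma grid_events_subset: "0 \<le> t \<Longrightarrow> grid_events t m \<subseteq> sets M"
  unfolding grid_events_def using measurable_sets[OF grid_path_measurable] by blast

lemma space_past [simp]: "space (past t) = space M"
  by (simp add: past_def space_measure_of_conv)

lemma sets_past: "sets (past t) = sigma_sets (space M) (\<Union>m. grid_events t m)"
  unfolding past_def by (rule sets_measure_of) (auto simp: grid_events_def)

lemma sets_past_subset: "0 \<le> t \<Longrightarrow> sets (past t) \<subseteq> sets M"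
  unfolding sets_past using grid_events_subset by (intro sets.sigma_sets_subset) blast

lemma past_measurable:
  assumes "i \<le> 2 ^ m"
  shows "B (t * (real i / 2 ^ m)) \<in> borel_measurable (past t)"
proof -
  have "grid_path t m \<in> measurable (past t) (grid_space m)"
  proof (rule measurableI)
    show "grid_path t m \<omega> \<in> space (grid_space m)" for \<omega>
      by (auto simp: grid_path_def space_PiM)
    show "grid_path t m -` A \<inter> space (past t) \<in> sets (past t)" if "A \<in> sets (grid_space m)" for A
      unfolding sets_past space_past using that
      by (intro sigma_sets.Basic) (auto simp: grid_events_def)
  qed
  from measurable_compose[OF this measurable_component_singleton[of i]] assms
  have "(\<lambda>\<omega>. grid_path t m \<omega> i) \<in> borel_measurable (past t)" by auto
  then show ?thesis using assms by (simp add: grid_path_def)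
qed

lemma past_measurable_present: "B t \<in> borel_measurable (past t)"
  using past_measurable[of 1 0 t] by simp

lemma increment_indep_past:
  assumes t: "0 \<le> t" and h: "0 \<le> h" and A: "A \<in> sets (past t)" and C: "C \<in> sets borel"
  shows "prob (A \<inter> ((\<lambda>\<omega>. B (t + h) \<omega> - B t \<omega>) -` C \<inter> space M))
    = prob A * prob ((\<lambda>\<omega>. B (t + h) \<omega> - B t \<omega>) -` C \<inter> space M)"
proof -
  let ?D = "\<lambda>\<omega>. B (t + h) \<omega> - B t \<omega>"
  let ?H = "{?D -` A \<inter> space M | A. A \<in> sets borel}"
  have D: "?D \<in> borel_measurable M" using t h by (intro borel_measurable_diff B_measurable) auto
  have "indep_set (sigma_sets (space M) (\<Union>m. grid_events t m)) (sigma_sets (space M) ?H)"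
  proof (rule indep_set_sigma_sets)
    show "indep_set (\<Union>m. grid_events t m) ?H"
    proof (rule indep_setI)
      show "(\<Union>m. grid_events t m) \<subseteq> events" using grid_events_subset[OF t] by blast
      show "?H \<subseteq> events" using measurable_sets[OF D] by blast
      fix a b assume "a \<in> (\<Union>m. grid_events t m)" "b \<in> ?H"
      then obtain m where "a \<in> grid_events t m" by blast
      with \<open>b \<in> ?H\<close> obtain A C where "A \<in> sets (grid_space m)" "C \<in> sets borel"
        "a = grid_path t m -` A \<inter> space M" "b = ?D -` C \<inter> space M"
        unfolding grid_events_def by blast
      then show "prob (a \<inter> b) = prob a * prob b" using grid_path_indep[OF t h] by simp
    qed
    show "Int_stable (\<Union>m. grid_events t m)"
    proof (rule Int_stableI)
      fix a b assume "a \<in> (\<Union>m. grid_events t m)" "b \<in> (\<Union>m. grid_events t m)"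
      then obtain m n where "a \<in> grid_events t m" "b \<in> grid_events t n" by blast
      then have "a \<in> grid_events t (max m n)" "b \<in> grid_events t (max m n)"
        using grid_events_mono[OF t, of m "max m n"] grid_events_mono[OF t, of n "max m n"] by auto
      then obtain A A' where "A \<in> sets (grid_space (max m n))" "A' \<in> sets (grid_space (max m n))"
        "a \<inter> b = grid_path t (max m n) -` (A \<inter> A') \<inter> space M"
        unfolding grid_events_def by blast
      then have "a \<inter> b \<in> grid_events t (max m n)" unfolding grid_events_def by blast
      then show "a \<inter> b \<in> (\<Union>m. grid_events t m)" by blast
    qed
    show "Int_stable ?H"
    proof (rule Int_stableI)
      fix a b assume "a \<in> ?H" "b \<in> ?H"
      then obtain A A' where "A \<in> sets borel" "A' \<in> sets borel" "a \<inter> b = ?D -` (A \<inter> A') \<inter> space M"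
        by blast
      then show "a \<inter> b \<in> ?H" by blast
    qed
  qed
  then show ?thesis
    by (rule indep_setD) (use A C in \<open>auto simp: sets_past intro!: sigma_sets.Basic\<close>)
qed

text \<open>
  Independence of the past and the next increment turns the joint law into a product measure, and
  Fubini integrates out the increment first. The past \<open>\<sigma>\<close>-algebra enters through the identity map,
  regarded as a random variable with values in \<open>past t\<close>.
\<close>
lemma markov_step:
  assumes t: "0 \<le> t" and h: "0 < h" and A: "A \<in> sets (past t)"
    and F [measurable]: "F \<in> borel_measurable borel"
  shows "(\<integral>\<^sup>+\<omega>. F (B (t + h) \<omega>) * indicator A \<omega> \<partial>M)
    = (\<integral>\<^sup>+\<omega>. (\<integral>\<^sup>+g. F (B t \<omega> + g) \<partial>gaussian2 h) * indicator A \<omega> \<partial>M)"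
proof -
  let ?D = "\<lambda>\<omega>. B (t + h) \<omega> - B t \<omega>"
  have [measurable]: "?D \<in> borel_measurable M" using t h by (intro borel_measurable_diff B_measurable) auto
  have [measurable]: "(\<lambda>\<omega>. \<omega>) \<in> measurable M (past t)"
    using sets_past_subset[OF t] sets.sets_into_space[of _ "past t"]
    by (intro measurableI) (auto simp: Int_absorb2)
  have [measurable]: "B t \<in> borel_measurable (past t)" by (rule past_measurable_present)
  note A [measurable]
  interpret D: prob_space "distr M borel ?D" by (rule prob_space_distr) measurable
  interpret N: prob_space "distr M (past t) (\<lambda>\<omega>. \<omega>)" by (rule prob_space_distr) measurable
  interpret P: pair_prob_space "distr M (past t) (\<lambda>\<omega>. \<omega>)" "distr M borel ?D" ..
  have D: "distr M (past t) (\<lambda>\<omega>. \<omega>) \<Otimes>\<^sub>M distr M borel ?D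
      = distr M (past t \<Otimes>\<^sub>M borel) (\<lambda>\<omega>. (\<omega>, ?D \<omega>))"
  proof (rule pair_measure_eqI)
    show "sigma_finite_measure (distr M (past t) (\<lambda>\<omega>. \<omega>))" "sigma_finite_measure (distr M borel ?D)"
      by unfold_locales
    fix A C assume "A \<in> sets (distr M (past t) (\<lambda>\<omega>. \<omega>))" "C \<in> sets (distr M borel ?D)"
    then have [measurable]: "A \<in> sets (past t)" "C \<in> sets borel" by auto
    have AM: "A \<inter> space M = A" using sets.sets_into_space[of A "past t"] by auto
    have "(\<lambda>\<omega>. (\<omega>, ?D \<omega>)) -` (A \<times> C) \<inter> space M = A \<inter> (?D -` C \<inter> space M)" using AM by auto
    then show "emeasure (distr M (past t) (\<lambda>\<omega>. \<omega>)) A * emeasure (distr M borel ?D) C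
        = emeasure (distr M (past t \<Otimes>\<^sub>M borel) (\<lambda>\<omega>. (\<omega>, ?D \<omega>))) (A \<times> C)"
      using increment_indep_past[OF t less_imp_le[OF h], of A C]
      by (simp add: emeasure_distr AM emeasure_eq_measure ennreal_mult'')
  qed simp
  let ?F = "\<lambda>z. F (B t (fst z) + snd z) * indicator A (fst z)"
  have "(\<integral>\<^sup>+\<omega>. F (B (t + h) \<omega>) * indicator A \<omega> \<partial>M) = (\<integral>\<^sup>+\<omega>. ?F (\<omega>, ?D \<omega>) \<partial>M)"
    by simp
  also have "\<dots> = (\<integral>\<^sup>+z. ?F z \<partial>distr M (past t \<Otimes>\<^sub>M borel) (\<lambda>\<omega>. (\<omega>, ?D \<omega>)))"
    by (subst nn_integral_distr) auto
  also have "\<dots> = (\<integral>\<^sup>+\<omega>. \<integral>\<^sup>+g. ?F (\<omega>, g) \<partial>distr M borel ?D \<partial>distr M (past t) (\<lambda>\<omega>. \<omega>))"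
    unfolding D[symmetric] by (subst D.nn_integral_fst[symmetric]) auto
  also have "\<dots> = (\<integral>\<^sup>+\<omega>. \<integral>\<^sup>+g. ?F (\<omega>, g) \<partial>distr M borel ?D \<partial>M)"
    by (subst nn_integral_distr) auto
  also have "\<dots> = (\<integral>\<^sup>+\<omega>. (\<integral>\<^sup>+g. F (B t \<omega> + g) \<partial>distr M borel ?D) * indicator A \<omega> \<partial>M)"
    by (simp add: nn_integral_multc)
  finally show ?thesis unfolding B_increment_distr[OF t h] .
qed

definition survive :: "real \<Rightarrow> 'v set" where
  "survive q = {\<omega> \<in> space M. \<forall>s. 0 < s \<and> s < q \<longrightarrow> B s \<omega> \<in> open_quadrant}"

text \<open>
  Staying in an open set up to time \<open>q\<close> can be read off from countably many times. On the compact
  interval between \<open>q / (n + 1)\<close> and \<open>q - q / (n + 1)\<close> both coordinates are bounded below by some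
  \<open>1 / (m + 1)\<close>; conversely, such a bound on a dense set of times passes to the limit.
  Hence the decision to stop before \<open>q\<close> depends only on the past, which is all that is needed of a
  stopping time here.
\<close>
lemma survive_iff_dyadic:
  assumes \<omega>: "\<omega> \<in> space M" and q: "0 < q"
  shows "(\<forall>s. 0 < s \<and> s < q \<longrightarrow> B s \<omega> \<in> open_quadrant) \<longleftrightarrow>
    (\<forall>n. \<exists>m. \<forall>l i. (i::nat) \<le> 2 ^ l \<and> 1 / Suc n \<le> i / 2 ^ l \<and> i / 2 ^ l \<le> 1 - 1 / Suc n \<longrightarrow>
       1 / Suc m \<le> fst (B (q * (i / 2 ^ l)) \<omega>) \<and> 1 / Suc m \<le> snd (B (q * (i / 2 ^ l)) \<omega>))"
    (is "?L \<longleftrightarrow> ?R")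
proof
  assume L: ?L
  show ?R
  proof
    fix n
    let ?I = "{q * (1 / Suc n) .. q * (1 - 1 / Suc n)}"
    let ?f = "\<lambda>s. min (fst (B s \<omega>)) (snd (B s \<omega>))"
    have I: "s \<in> ?I \<Longrightarrow> 0 < s \<and> s < q" for s
    proof -
      assume s: "s \<in> ?I"
      have "0 < q * (1 / Suc n)" "q * (1 - 1 / Suc n) < q * 1"
        using q by (auto intro!: mult_strict_left_mono)
      then show "0 < s \<and> s < q" using s by auto
    qed
    have pos: "0 < ?f s" if "s \<in> ?I" for s
      using L I[OF that] by (auto simp: open_quadrant_def mem_Times_iff)
    have "\<exists>m. \<forall>s\<in>?I. 1 / Suc m \<le> ?f s"
    proof (cases "?I = {}")
      case False
      have "continuous_on ?I ?f"
        using I by (intro continuous_intros continuous_on_subset[OF B_continuous[OF \<omega>]]) force+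
      with continuous_attains_inf[OF compact_Icc False] obtain s where
        s: "s \<in> ?I" "\<And>r. r \<in> ?I \<Longrightarrow> ?f s \<le> ?f r" by blast
      obtain m where "inverse (Suc m) < ?f s" using reals_Archimedean[OF pos[OF s(1)]] by blast
      then show ?thesis using s(2) by (intro exI[of _ m]) (fastforce simp: inverse_eq_divide)
    qed auto
    then obtain m where m: "\<And>s. s \<in> ?I \<Longrightarrow> 1 / Suc m \<le> ?f s" by blast
    show "\<exists>m. \<forall>l i. (i::nat) \<le> 2 ^ l \<and> 1 / Suc n \<le> i / 2 ^ l \<and> i / 2 ^ l \<le> 1 - 1 / Suc n \<longrightarrow>
       1 / Suc m \<le> fst (B (q * (i / 2 ^ l)) \<omega>) \<and> 1 / Suc m \<le> snd (B (q * (i / 2 ^ l)) \<omega>)"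
    proof (intro exI[of _ m] allI impI)
      fix l i :: nat assume "i \<le> 2 ^ l \<and> 1 / Suc n \<le> i / 2 ^ l \<and> i / 2 ^ l \<le> 1 - 1 / Suc n"
      then have "q * (i / 2 ^ l) \<in> ?I"
        unfolding atLeastAtMost_iff using q by (intro conjI mult_left_mono) auto
      from m[OF this]
      show "1 / Suc m \<le> fst (B (q * (i / 2 ^ l)) \<omega>) \<and> 1 / Suc m \<le> snd (B (q * (i / 2 ^ l)) \<omega>)"
        by (simp only: min.bounded_iff)
    qed
  qed
next
  assume R: ?R
  show ?L
  proof (intro allI impI)
    fix s assume s: "0 < s \<and> s < q"
    define a where "a = s / q"
    have a: "0 < a" "a < 1" using s q by (auto simp: a_def)
    obtain n where n: "inverse (Suc n) < min a (1 - a)" using reals_Archimedean[of "min a (1 - a)"] a by auto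
    obtain m where m: "\<And>l i. (i::nat) \<le> 2 ^ l \<Longrightarrow> 1 / Suc n \<le> i / 2 ^ l \<Longrightarrow> i / 2 ^ l \<le> 1 - 1 / Suc n \<Longrightarrow>
       1 / Suc m \<le> fst (B (q * (i / 2 ^ l)) \<omega>) \<and> 1 / Suc m \<le> snd (B (q * (i / 2 ^ l)) \<omega>)"
      using R by blast
    let ?d = "\<lambda>l. real (dyadic_right a l) / 2 ^ l"
    have d: "?d \<longlonglongrightarrow> a" using dyadic_right_tendsto a by simp
    have "(\<lambda>l. q * ?d l) \<longlonglongrightarrow> q * a" by (intro tendsto_intros d)
    then have lim: "(\<lambda>l. B (q * ?d l) \<omega>) \<longlonglongrightarrow> B s \<omega>"
      using B_tendsto[OF \<omega>, of s "\<lambda>l. q * ?d l"] s q by (simp add: a_def)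
    have "eventually (\<lambda>l. 1 / Suc n < ?d l) sequentially" "eventually (\<lambda>l. ?d l < 1 - 1 / Suc n) sequentially"
      using n by (auto intro!: order_tendstoD[OF d] simp: inverse_eq_divide)
    then have ev: "eventually (\<lambda>l. 1 / Suc m \<le> fst (B (q * ?d l) \<omega>) \<and> 1 / Suc m \<le> snd (B (q * ?d l) \<omega>)) sequentially"
    proof eventually_elim
      case (elim l)
      have "1 - 1 / real (Suc n) \<le> 1" by simp
      then have "?d l \<le> 1" using elim by linarith
      then have "real (dyadic_right a l) \<le> 2 ^ l" by (simp add: field_simps)
      then have "dyadic_right a l \<le> 2 ^ l" by (metis of_nat_le_iff of_nat_numeral of_nat_power)
      then show ?case using m[of "dyadic_right a l" l] elim by linarith
    qed
    have "1 / Suc m \<le> fst (B s \<omega>)"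
      using ev by (intro tendsto_lowerbound[OF tendsto_fst[OF lim]]) (auto elim: eventually_mono)
    moreover have "1 / Suc m \<le> snd (B s \<omega>)"
      using ev by (intro tendsto_lowerbound[OF tendsto_snd[OF lim]]) (auto elim: eventually_mono)
    moreover have "0 < 1 / real (Suc m)" by simp
    ultimately have "0 < fst (B s \<omega>)" "0 < snd (B s \<omega>)" by (blast intro: less_le_trans)+
    then show "B s \<omega> \<in> open_quadrant" by (simp add: open_quadrant_def mem_Times_iff)
  qed
qed

lemma survive_past:
  assumes "0 \<le> q"
  shows "survive q \<in> sets (past q)"
proof (cases "q = 0")
  case True
  then have "survive q = space (past q)" by (auto simp: survive_def)
  then show ?thesis by (simp only: sets.top)
next
  case False
  then have q: "0 < q" using assms by simp
  have [measurable]: "(fst :: real \<times> real \<Rightarrow> real) \<in> borel_measurable borel"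
    "(snd :: real \<times> real \<Rightarrow> real) \<in> borel_measurable borel"
    by (intro borel_measurable_continuous_onI continuous_intros)+
  have m: "Measurable.pred (past q) (\<lambda>\<omega>. i \<le> 2 ^ l \<and> 1 / Suc n \<le> i / 2 ^ l \<and> i / 2 ^ l \<le> 1 - 1 / Suc n \<longrightarrow>
       1 / Suc m \<le> fst (B (q * (i / 2 ^ l)) \<omega>) \<and> 1 / Suc m \<le> snd (B (q * (i / 2 ^ l)) \<omega>))" for i l n m :: nat
  proof (cases "i \<le> 2 ^ l")
    case True
    note past_measurable[OF True, of q, measurable]
    show ?thesis by measurable
  qed simp
  have "survive q = {\<omega> \<in> space (past q).
    \<forall>n. \<exists>m. \<forall>l i. (i::nat) \<le> 2 ^ l \<and> 1 / Suc n \<le> i / 2 ^ l \<and> i / 2 ^ l \<le> 1 - 1 / Suc n \<longrightarrow>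
       1 / Suc m \<le> fst (B (q * (i / 2 ^ l)) \<omega>) \<and> 1 / Suc m \<le> snd (B (q * (i / 2 ^ l)) \<omega>)}"
    using survive_iff_dyadic[OF _ q] by (auto simp: survive_def)
  also have "\<dots> \<in> sets (past q)"
    by (intro predE pred_intros_countable m)
  finally show ?thesis .
qed

end

section \<open>The exit law of the quadrant\<close>

text \<open>
  On the event that the path never leaves the quadrant the exit time is an arbitrary real number,
  possibly negative, where the Brownian path is unconstrained. The exit point can therefore fail
  to be measurable on that null event. In this case the image of the probability measure is not
  countably additive: some set and its complement both have non-measurable preimages, to which
  \<^const>\<open>emeasure\<close> assigns 0, while the whole space has mass 1. The image measure is then the null measure,
  for which every upper bound on an integral is trivial.
\<close>
lemma nn_integral_distr_nonmeasurable:
  assumes M: "emeasure M (space M) \<noteq> 0" and f: "f \<in> space M \<rightarrow> space N" "f \<notin> measurable M N"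
  shows "(\<integral>\<^sup>+z. F z \<partial>distr M N f) = 0"
proof -
  let ?\<mu> = "\<lambda>A. emeasure M (f -` A \<inter> space M)"
  obtain A where A: "A \<in> sets N" "f -` A \<inter> space M \<notin> sets M"
    using f unfolding measurable_def by blast
  have compl: "f -` (space N - A) \<inter> space M = space M - (f -` A \<inter> space M)" using f(1) by auto
  have "f -` (space N - A) \<inter> space M \<notin> sets M"
  proof
    assume "f -` (space N - A) \<inter> space M \<in> sets M"
    then have "space M - (f -` (space N - A) \<inter> space M) \<in> sets M" by auto
    moreover have "space M - (f -` (space N - A) \<inter> space M) = f -` A \<inter> space M" unfolding compl by auto
    ultimately show False using A by simp
  qed
  then have zero: "?\<mu> A = 0" "?\<mu> (space N - A) = 0" using A by (auto simp: emeasure_notin_sets)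
  have "\<not> measure_space (space N) (sets N) ?\<mu>"
  proof
    assume ms: "measure_space (space N) (sets N) ?\<mu>"
    have em: "emeasure (distr M N f) C = ?\<mu> C" if "C \<in> sets N" for C
      using that ms by (simp add: distr_def emeasure_measure_of_conv sets.space_closed sets.sigma_sets_eq)
    have "emeasure (distr M N f) (space N) = emeasure (distr M N f) A + emeasure (distr M N f) (space N - A)"
      using A sets.sets_into_space[OF A(1)] by (subst plus_emeasure) (auto simp: Un_absorb1)
    then have "?\<mu> (space N) = 0" using A zero by (simp add: em)
    moreover have "f -` space N \<inter> space M = space M" using f(1) by auto
    ultimately show False using M by simp
  qed
  then have "emeasure (distr M N f) C = 0" for C
    by (simp add: distr_def emeasure_measure_of_conv sets.space_closed sets.sigma_sets_eq)
  then have "AE z in distr M N f. F z = 0"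
    by (intro AE_I[of _ _ "space (distr M N f)"]) auto
  then have "(\<integral>\<^sup>+z. F z \<partial>distr M N f) = (\<integral>\<^sup>+z. 0 \<partial>distr M N f)" by (rule nn_integral_cong_AE)
  then show ?thesis by simp
qed

text \<open>
  The marginal density is at most \<open>1 / sqrt h\<close>, so a spreading Gaussian leaves every fixed strip.
\<close>
lemma gaussian2_strip:
  assumes "0 < h" "a \<le> b"
  shows "emeasure (gaussian2 h) ({a..b} \<times> UNIV) \<le> ennreal ((b - a) / sqrt h)"
proof -
  let ?n = "normal_density 0 (sqrt h)"
  interpret prob_space "density lborel (\<lambda>v. ennreal (?n v))"
    using assms by (intro prob_space_normal_density) simp
  have one: "(\<integral>\<^sup>+v. ennreal (?n v) \<partial>lborel) = 1"
    using emeasure_space_1 by (simp add: emeasure_density)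
  have le: "?n u \<le> 1 / sqrt h" for u
  proof -
    have "?n u = 1 / sqrt (2 * pi * h) * exp (- u\<^sup>2 / (2 * h))"
      using assms by (simp add: normal_density_def)
    also have "\<dots> \<le> 1 / sqrt (2 * pi * h) * 1"
      using assms by (intro mult_left_mono) auto
    also have "\<dots> \<le> 1 / sqrt h"
    proof -
      have "1 * h \<le> 2 * pi * h" using assms pi_gt3 by (intro mult_right_mono) auto
      then show ?thesis using assms by (simp add: frac_le)
    qed
    finally show ?thesis .
  qed
  have S: "{a..b} \<times> UNIV \<in> sets (borel :: (real \<times> real) measure)"
    by (intro borel_closed closed_Times) auto
  have "emeasure (gaussian2 h) ({a..b} \<times> UNIV)
      = (\<integral>\<^sup>+z. ennreal (gaussian_density2 h z) * indicator ({a..b} \<times> UNIV) z \<partial>lborel)"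
    unfolding gaussian2_def using S by (intro emeasure_density) auto
  also have "\<dots> = (\<integral>\<^sup>+z. (ennreal (?n (fst z)) * indicator {a..b} (fst z)) * ennreal (?n (snd z))
      \<partial>(lborel \<Otimes>\<^sub>M lborel))"
    unfolding lborel_prod
    by (intro nn_integral_cong) (auto simp: gaussian_density2_def ennreal_mult' indicator_def)
  also have "\<dots> = (\<integral>\<^sup>+u. \<integral>\<^sup>+v. (ennreal (?n u) * indicator {a..b} u) * ennreal (?n v) \<partial>lborel \<partial>lborel)"
    by (subst lborel.nn_integral_fst[symmetric]) auto
  also have "\<dots> = (\<integral>\<^sup>+u. ennreal (?n u) * indicator {a..b} u \<partial>lborel)"
    by (simp add: nn_integral_cmult one)
  also have "\<dots> \<le> (\<integral>\<^sup>+u. ennreal (1 / sqrt h) * indicator {a..b} u \<partial>lborel)"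
    using le by (intro nn_integral_mono mult_right_mono ennreal_leI) auto
  also have "\<dots> = ennreal ((b - a) / sqrt h)"
    using assms by (simp add: nn_integral_cmult ennreal_mult'[symmetric])
  finally show ?thesis .
qed

context planar_brownian
begin

definition exits :: "'v \<Rightarrow> bool" where
  "exits \<omega> \<longleftrightarrow> (\<exists>s>0. B s \<omega> \<notin> open_quadrant)"

lemma exit_time_nonneg:
  assumes "exits \<omega>"
  shows "0 \<le> exit_time B \<omega>"
  unfolding exit_time_def using assms by (intro cInf_greatest) (auto simp: exits_def)

text \<open>
  The infimum over the empty set never enters, because survival fails only when there is an exit.
\<close>
lemma not_survive_iff:
  assumes "\<omega> \<in> space M"
  shows "\<omega> \<notin> survive q \<longleftrightarrow> exits \<omega> \<and> exit_time B \<omega> < q"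
proof
  let ?S = "{t. t > 0 \<and> B t \<omega> \<notin> open_quadrant}"
  assume "\<omega> \<notin> survive q"
  then obtain s where s: "s \<in> ?S" "s < q" using assms by (auto simp: survive_def)
  have "bdd_below ?S" by (intro bdd_belowI[of _ 0]) auto
  then have "exit_time B \<omega> \<le> s" unfolding exit_time_def using s by (intro cInf_lower)
  then show "exits \<omega> \<and> exit_time B \<omega> < q" using s by (auto simp: exits_def)
next
  let ?S = "{t. t > 0 \<and> B t \<omega> \<notin> open_quadrant}"
  assume e: "exits \<omega> \<and> exit_time B \<omega> < q"
  then have "?S \<noteq> {}" by (auto simp: exits_def)
  with e obtain s where "s \<in> ?S" "s < q" unfolding exit_time_def by (meson cInf_lessD)
  then show "\<omega> \<notin> survive q" by (auto simp: survive_def)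
qed

lemma survive_antimono: "p \<le> q \<Longrightarrow> survive q \<subseteq> survive p"
  by (auto simp: survive_def)

lemma survive_sets [measurable]: "0 \<le> q \<Longrightarrow> survive q \<in> sets M"
  using survive_past sets_past_subset by blast

lemma survive_closed_quadrant:
  assumes x: "x \<in> closed_quadrant" and \<omega>: "\<omega> \<in> survive q" and q: "0 \<le> q"
  shows "B q \<omega> \<in> closed_quadrant"
proof (cases "q = 0")
  case True
  then show ?thesis using B_start \<omega> x by (simp add: survive_def)
next
  case False
  then have q: "0 < q" using q by simp
  \<comment> \<open>Approach \<open>q\<close> from below through times at which the path is still in the open quadrant.\<close>
  let ?s = "\<lambda>n::nat. q * (1 - 1 / 2 ^ Suc n)"
  have "?s \<longlonglongrightarrow> q * (1 - 0)"
    by (intro tendsto_intros LIMSEQ_Suc inverse_two_power_tendsto)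
  then have sq: "?s \<longlonglongrightarrow> q" by simp
  have s: "0 < ?s n" "?s n < q" for n
  proof -
    have "(1::real) < 2 ^ Suc n" by (rule one_less_power) auto
    then have "0 < 1 - 1 / (2::real) ^ Suc n" "1 - 1 / (2::real) ^ Suc n < 1" by (auto simp: divide_less_eq)
    then show "0 < ?s n" "?s n < q" using q mult_strict_left_mono[of _ 1 q] by (simp, fastforce)
  qed
  have \<omega>': "\<omega> \<in> space M" using \<omega> by (simp add: survive_def)
  have lim: "(\<lambda>n. B (?s n) \<omega>) \<longlonglongrightarrow> B q \<omega>"
    by (rule B_tendsto[OF \<omega>' less_imp_le[OF q] less_imp_le[OF s(1)] sq])
  have "B (?s n) \<omega> \<in> closed_quadrant" for n
    using \<omega> s[of n] unfolding survive_def
    by (auto simp: closed_quadrant_def open_quadrant_def mem_Times_iff intro!: less_imp_le)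
  moreover have "closed closed_quadrant" unfolding closed_quadrant_def by (intro closed_Times) auto
  ultimately show ?thesis using lim by (meson closed_sequentially)
qed

lemma exit_point_closed_quadrant:
  assumes "x \<in> closed_quadrant" "\<omega> \<in> space M" "exits \<omega>"
  shows "B (exit_time B \<omega>) \<omega> \<in> closed_quadrant"
  using survive_closed_quadrant[OF assms(1) _ exit_time_nonneg[OF assms(3)]]
    not_survive_iff[OF assms(2)] by blast

text \<open>
  Brownian motion at the times \<open>0, h, 2 h, \<dots>\<close>, halted at the first of them that lies strictly after
  the exit time. Deciding this from the whole path before the grid time, instead of from the grid
  values, makes the halting times converge to the exit time itself as the grid is refined. In
  particular a start on an axis, where the exit is immediate, needs no separate treatment.
\<close>
fun walk :: "real \<Rightarrow> nat \<Rightarrow> 'v \<Rightarrow> real \<times> real" where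
  "walk h 0 \<omega> = B 0 \<omega>"
| "walk h (Suc k) \<omega> = (if \<omega> \<in> survive (h * real k) then B (h * real k + h) \<omega> else walk h k \<omega>)"

lemma walk_measurable [measurable]:
  assumes "0 \<le> h"
  shows "walk h k \<in> borel_measurable M"
proof (induction k)
  case 0
  have "walk h 0 = B 0" by (simp add: fun_eq_iff)
  then show ?case by simp
next
  case (Suc k)
  have "walk h (Suc k) = (\<lambda>\<omega>. if \<omega> \<in> survive (h * real k) then B (h * real k + h) \<omega> else walk h k \<omega>)"
    by (simp add: fun_eq_iff)
  moreover have "\<dots> \<in> borel_measurable M"
    using assms Suc by (intro measurable_If_set B_measurable) auto
  ultimately show ?case by simp
qed

lemma walk_survive:
  assumes "\<omega> \<in> survive (h * real k)" "0 \<le> h"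
  shows "walk h k \<omega> = B (h * real k) \<omega>"
proof (cases k)
  case (Suc j)
  have "h * real j \<le> h * real k" using assms Suc by (intro mult_left_mono) auto
  then show ?thesis using survive_antimono[of "h * real j" "h * real k"] assms Suc
    by (auto simp: algebra_simps)
qed simp

lemma walk_position:
  assumes \<omega>: "\<omega> \<in> space M" and h: "0 \<le> h"
  shows "\<exists>s\<ge>0. walk h k \<omega> = B s \<omega> \<and>
    (\<omega> \<in> survive (h * real k) \<or> (exit_time B \<omega> \<le> s \<and> s \<le> exit_time B \<omega> + h))"
proof (induction k)
  case 0
  have "\<omega> \<in> survive (h * real 0)" using \<omega> by (auto simp: survive_def)
  then show ?case by (intro exI[of _ 0]) simp
next
  case (Suc k)
  show ?case
  proof (cases "\<omega> \<in> survive (h * real k)")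
    case True
    have "exit_time B \<omega> \<le> h * real k + h \<and> h * real k + h \<le> exit_time B \<omega> + h"
      if "\<omega> \<notin> survive (h * real (Suc k))"
    proof -
      have "h * real (Suc k) = h * real k + h" by (simp add: distrib_left)
      then have "exits \<omega>" "exit_time B \<omega> < h * real k + h"
        using that not_survive_iff[OF \<omega>, of "h * real (Suc k)"] by auto
      moreover have "h * real k \<le> exit_time B \<omega>"
        using True \<open>exits \<omega>\<close> not_survive_iff[OF \<omega>, of "h * real k"] by auto
      ultimately show ?thesis by linarith
    qed
    with True show ?thesis using h by (intro exI[of _ "h * real k + h"]) auto
  next
    case False
    then show ?thesis using Suc by auto
  qed
qed

text \<open>
  Optional stopping for the walk: until it halts, the next step is an independent Gaussian
  increment and costs the drift of \<open>lyapunov_gaussian_step\<close>; afterwards nothing is added.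
\<close>
lemma walk_lyapunov:
  assumes e: "0 < e" "e \<le> 1" and \<delta>: "0 < \<delta>" and h: "0 < h" "h \<le> 1"
  shows "(\<integral>\<^sup>+\<omega>. ennreal (lyapunov e \<delta> (walk h k \<omega>)) \<partial>M)
    \<le> ennreal (lyapunov e \<delta> x + real k * (2 * \<delta> * h + 5 * (5 / e + 6 / e\<^sup>2) * (h * sqrt h)))"
proof (induction k)
  case 0
  have "(\<integral>\<^sup>+\<omega>. ennreal (lyapunov e \<delta> (walk h 0 \<omega>)) \<partial>M) = (\<integral>\<^sup>+\<omega>. ennreal (lyapunov e \<delta> x) \<partial>M)"
    by (intro nn_integral_cong) (simp add: B_start)
  then show ?case by (simp add: emeasure_space_1)
next
  case (Suc k)
  define c where "c = 2 * \<delta> * h + 5 * (5 / e + 6 / e\<^sup>2) * (h * sqrt h)"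
  have c: "0 \<le> c" using e \<delta> h by (simp add: c_def)
  define S where "S = survive (h * real k)"
  let ?L = "\<lambda>z. ennreal (lyapunov e \<delta> z)"
  have V: "0 \<le> lyapunov e \<delta> z" for z
    using log_potential_lower_bound[OF e \<delta>] by (simp add: lyapunov_def)
  have [measurable]: "S \<in> sets M" unfolding S_def using h by simp
  have [measurable]: "walk h k \<in> borel_measurable M" "B (h * real k + h) \<in> borel_measurable M"
    using h by simp_all
  have [measurable]: "lyapunov e \<delta> \<in> borel_measurable borel"
    unfolding lyapunov_def by measurable
  have "(\<integral>\<^sup>+\<omega>. ?L (walk h (Suc k) \<omega>) \<partial>M)
    = (\<integral>\<^sup>+\<omega>. ?L (B (h * real k + h) \<omega>) * indicator S \<omega> + ?L (walk h k \<omega>) * indicator (space M - S) \<omega> \<partial>M)"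
    by (intro nn_integral_cong) (auto simp: S_def indicator_def)
  also have "\<dots> = (\<integral>\<^sup>+\<omega>. ?L (B (h * real k + h) \<omega>) * indicator S \<omega> \<partial>M)
      + (\<integral>\<^sup>+\<omega>. ?L (walk h k \<omega>) * indicator (space M - S) \<omega> \<partial>M)"
    by (rule nn_integral_add) measurable
  also have "(\<integral>\<^sup>+\<omega>. ?L (B (h * real k + h) \<omega>) * indicator S \<omega> \<partial>M)
      = (\<integral>\<^sup>+\<omega>. (\<integral>\<^sup>+g. ?L (B (h * real k) \<omega> + g) \<partial>gaussian2 h) * indicator S \<omega> \<partial>M)"
    using h by (intro markov_step) (auto simp: S_def survive_past)
  also have "\<dots> \<le> (\<integral>\<^sup>+\<omega>. (?L (walk h k \<omega>) + ennreal c) * indicator S \<omega> \<partial>M)"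
  proof (intro nn_integral_mono)
    fix \<omega>
    show "(\<integral>\<^sup>+g. ?L (B (h * real k) \<omega> + g) \<partial>gaussian2 h) * indicator S \<omega>
        \<le> (?L (walk h k \<omega>) + ennreal c) * indicator S \<omega>"
      using lyapunov_gaussian_step[OF e \<delta> h, of "B (h * real k) \<omega>"] walk_survive[of \<omega> h k] h V c
      by (auto simp: indicator_def S_def c_def add.assoc simp flip: ennreal_plus)
  qed
  also have "\<dots> + (\<integral>\<^sup>+\<omega>. ?L (walk h k \<omega>) * indicator (space M - S) \<omega> \<partial>M)
      = (\<integral>\<^sup>+\<omega>. (?L (walk h k \<omega>) + ennreal c) * indicator S \<omega>
          + ?L (walk h k \<omega>) * indicator (space M - S) \<omega> \<partial>M)"
    by (rule nn_integral_add[symmetric]) measurable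
  also have "\<dots> \<le> (\<integral>\<^sup>+\<omega>. ?L (walk h k \<omega>) + ennreal c \<partial>M)"
    by (intro nn_integral_mono) (auto simp: indicator_def)
  also have "\<dots> = (\<integral>\<^sup>+\<omega>. ?L (walk h k \<omega>) \<partial>M) + ennreal c"
    by (simp add: nn_integral_add emeasure_space_1)
  also have "\<dots> \<le> ennreal (lyapunov e \<delta> x + real k * c) + ennreal c"
    using Suc by (intro add_right_mono) (simp add: c_def)
  also have "\<dots> = ennreal (lyapunov e \<delta> x + real (Suc k) * c)"
    using V c by (subst ennreal_plus[symmetric]) (auto simp: algebra_simps)
  finally show ?case by (simp add: c_def add_right_mono)
qed

text \<open>
  The Brownian path at the minimum of the exit time and \<open>N\<close>.
\<close>
definition stopped :: "nat \<Rightarrow> 'v \<Rightarrow> real \<times> real" where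
  "stopped N \<omega> = (if \<omega> \<in> survive N then B N \<omega> else B (exit_time B \<omega>) \<omega>)"

lemma walk_tendsto_stopped:
  assumes \<omega>: "\<omega> \<in> space M"
  shows "(\<lambda>n. walk (1 / 2 ^ n) (N * 2 ^ n) \<omega>) \<longlonglongrightarrow> stopped N \<omega>"
proof (cases "\<omega> \<in> survive N")
  case True
  then show ?thesis
    using walk_survive[of \<omega> "1 / 2 ^ _" "N * 2 ^ _"] by (simp add: stopped_def)
next
  case False
  then have \<tau>: "exits \<omega>" using not_survive_iff[OF \<omega>] by blast
  have "\<exists>s\<ge>0. walk (1 / 2 ^ n) (N * 2 ^ n) \<omega> = B s \<omega> \<and> exit_time B \<omega> \<le> s \<and> s \<le> exit_time B \<omega> + 1 / 2 ^ n" for n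
    using walk_position[OF \<omega>, of "1 / 2 ^ n" "N * 2 ^ n"] False by auto
  then obtain s where s: "\<And>n. 0 \<le> s n" "\<And>n. walk (1 / 2 ^ n) (N * 2 ^ n) \<omega> = B (s n) \<omega>"
    "\<And>n. exit_time B \<omega> \<le> s n" "\<And>n. s n \<le> exit_time B \<omega> + 1 / 2 ^ n" by metis
  have "s \<longlonglongrightarrow> exit_time B \<omega>"
  proof (rule tendsto_sandwich[of "\<lambda>_. exit_time B \<omega>" _ _ "\<lambda>n. exit_time B \<omega> + 1 / 2 ^ n"])
    show "(\<lambda>n. exit_time B \<omega> + 1 / 2 ^ n) \<longlonglongrightarrow> exit_time B \<omega>"
      using tendsto_add[OF tendsto_const inverse_two_power_tendsto, of "exit_time B \<omega>"] by simp
  qed (use s in auto)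
  from B_tendsto[OF \<omega> exit_time_nonneg[OF \<tau>] s(1) this] show ?thesis
    using False by (simp add: s(2) stopped_def)
qed

lemma stopped_measurable [measurable]: "stopped N \<in> borel_measurable M"
  by (rule borel_measurable_LIMSEQ_metric[OF walk_measurable walk_tendsto_stopped]) auto

lemma stopped_closed_quadrant:
  assumes "x \<in> closed_quadrant" "\<omega> \<in> space M"
  shows "stopped N \<omega> \<in> closed_quadrant"
  using survive_closed_quadrant[OF assms(1), of \<omega> N] exit_point_closed_quadrant[OF assms]
    not_survive_iff[OF assms(2), of N] by (auto simp: stopped_def)

text \<open>
  Fatou's lemma along the dyadic grids: the walks converge to the stopped path by continuity, and
  the errors of order \<open>h\<^sup>3\<^sup>/\<^sup>2\<close> vanish.
\<close>
lemma stopped_lyapunov: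
  assumes e: "0 < e" "e \<le> 1" and \<delta>: "0 < \<delta>"
  shows "(\<integral>\<^sup>+\<omega>. ennreal (lyapunov e \<delta> (stopped N \<omega>)) \<partial>M) \<le> ennreal (lyapunov e \<delta> x + 2 * \<delta> * N)"
proof -
  let ?L = "\<lambda>z. ennreal (lyapunov e \<delta> z)"
  let ?W = "\<lambda>n. walk (1 / 2 ^ n) (N * 2 ^ n)"
  let ?K = "5 * (5 / e + 6 / e\<^sup>2)"
  have cont: "continuous_on UNIV (lyapunov e \<delta>)"
    unfolding lyapunov_def using continuous_on_log_potential[OF e(1)]
    by (intro continuous_intros)
  have [measurable]: "lyapunov e \<delta> \<in> borel_measurable borel"
    using cont by (rule borel_measurable_continuous_onI)
  have lim: "(\<lambda>n. ?L (?W n \<omega>)) \<longlonglongrightarrow> ?L (stopped N \<omega>)" if "\<omega> \<in> space M" for \<omega>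
    using walk_tendsto_stopped[OF that, of N]
    by (intro tendsto_ennrealI continuous_on_tendsto_compose[OF cont]) auto
  have "(\<integral>\<^sup>+\<omega>. ?L (stopped N \<omega>) \<partial>M) = (\<integral>\<^sup>+\<omega>. liminf (\<lambda>n. ?L (?W n \<omega>)) \<partial>M)"
    by (intro nn_integral_cong lim_imp_Liminf[symmetric] lim) auto
  also have "\<dots> \<le> liminf (\<lambda>n. \<integral>\<^sup>+\<omega>. ?L (?W n \<omega>) \<partial>M)"
    by (rule nn_integral_liminf) measurable
  also have "\<dots> \<le> liminf (\<lambda>n. ennreal (lyapunov e \<delta> x + real N * (2 * \<delta> + ?K * sqrt (1 / 2 ^ n))))"
  proof (intro Liminf_mono always_eventually allI)
    fix n
    have "real (N * 2 ^ n) * (2 * \<delta> * (1 / 2 ^ n) + ?K * ((1 / 2 ^ n) * sqrt (1 / 2 ^ n)))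
        = real N * (2 ^ n * (1 / 2 ^ n)) * (2 * \<delta> + ?K * sqrt (1 / 2 ^ n))"
      unfolding of_nat_mult of_nat_power of_nat_numeral by (simp only: algebra_simps)
    also have "\<dots> = real N * (2 * \<delta> + ?K * sqrt (1 / 2 ^ n))" by simp
    finally have eq: "real (N * 2 ^ n) * (2 * \<delta> * (1 / 2 ^ n) + ?K * ((1 / 2 ^ n) * sqrt (1 / 2 ^ n)))
        = real N * (2 * \<delta> + ?K * sqrt (1 / 2 ^ n))" .
    have "0 < 1 / (2::real) ^ n" "1 / (2::real) ^ n \<le> 1" by auto
    from walk_lyapunov[OF e \<delta> this, of "N * 2 ^ n"]
    show "(\<integral>\<^sup>+\<omega>. ?L (?W n \<omega>) \<partial>M)
        \<le> ennreal (lyapunov e \<delta> x + real N * (2 * \<delta> + ?K * sqrt (1 / 2 ^ n)))"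
      unfolding eq .
  qed
  also have "\<dots> = ennreal (lyapunov e \<delta> x + real N * (2 * \<delta> + ?K * sqrt 0))"
    by (intro lim_imp_Liminf tendsto_ennrealI tendsto_intros inverse_two_power_tendsto) simp
  finally show ?thesis by (simp add: mult_ac)
qed

text \<open>
  The stopped path stays in the closed quadrant, where the potential is nonnegative without help
  from the quadratic term. The constant cancels, and \<open>\<delta>\<close> tends to 0 with \<open>N\<close> fixed.
\<close>
lemma stopped_log_potential:
  assumes e: "0 < e" "e \<le> 1" and x: "x \<in> closed_quadrant"
  shows "(\<integral>\<^sup>+\<omega>. ennreal (log_potential e (stopped N \<omega>)) \<partial>M) \<le> ennreal (log_potential e x)"
proof (rule ennreal_le_epsilon)
  fix r :: real assume r: "0 < r"
  \<comment> \<open>This makes the total drift \<open>\<delta> (|x|\<^sup>2 + 2 N)\<close> at most \<open>r\<close>; adding 1 avoids division by zero.\<close>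
  define \<delta> where "\<delta> = r / ((norm x)\<^sup>2 + 2 * N + 1)"
  have d: "0 < (norm x)\<^sup>2 + 2 * real N + 1" by (intro add_nonneg_pos add_nonneg_nonneg) auto
  have \<delta>: "0 < \<delta>" using r d by (simp add: \<delta>_def)
  let ?C = "9 / (4 * \<delta>)"
  have C: "0 \<le> ?C" using \<delta> by simp
  note lp = log_potential_quadrant(1)[OF e]
  have "ennreal ?C + (\<integral>\<^sup>+\<omega>. ennreal (log_potential e (stopped N \<omega>)) \<partial>M)
      = (\<integral>\<^sup>+\<omega>. ennreal ?C + ennreal (log_potential e (stopped N \<omega>)) \<partial>M)"
    by (subst nn_integral_add) (auto simp: emeasure_space_1)
  also have "\<dots> \<le> (\<integral>\<^sup>+\<omega>. ennreal (lyapunov e \<delta> (stopped N \<omega>)) \<partial>M)"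
  proof (intro nn_integral_mono)
    fix \<omega> assume "\<omega> \<in> space M"
    then show "ennreal ?C + ennreal (log_potential e (stopped N \<omega>)) \<le> ennreal (lyapunov e \<delta> (stopped N \<omega>))"
      using lp[OF stopped_closed_quadrant[OF x]] C \<delta>
      by (subst ennreal_plus[symmetric]) (auto intro!: ennreal_leI simp: lyapunov_def)
  qed
  also have "\<dots> \<le> ennreal (lyapunov e \<delta> x + 2 * \<delta> * N)" by (rule stopped_lyapunov[OF e \<delta>])
  also have "\<dots> \<le> ennreal (?C + (log_potential e x + r))"
  proof (rule ennreal_leI)
    have "\<delta> * ((norm x)\<^sup>2 + 2 * real N) \<le> \<delta> * ((norm x)\<^sup>2 + 2 * real N + 1)"
      using \<delta> by (intro mult_left_mono) auto
    also have "\<dots> = r" using d by (simp add: \<delta>_def)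
    finally have "\<delta> * (norm x)\<^sup>2 + 2 * \<delta> * real N \<le> r" by (simp add: algebra_simps)
    then show "lyapunov e \<delta> x + 2 * \<delta> * real N \<le> ?C + (log_potential e x + r)"
      unfolding lyapunov_def by linarith
  qed
  also have "\<dots> = ennreal ?C + (ennreal (log_potential e x) + ennreal r)"
    using C lp[OF x] r by (simp add: ennreal_plus)
  finally show "(\<integral>\<^sup>+\<omega>. ennreal (log_potential e (stopped N \<omega>)) \<partial>M) \<le> ennreal (log_potential e x) + ennreal r"
    by (simp add: ennreal_add_left_cancel_le)
qed

text \<open>
  If the path survives until time \<open>N\<close>, then either its first coordinate lies in a strip of width \<open>A\<close>,
  which has probability at most \<open>A / sqrt N\<close>, or that coordinate exceeds \<open>A\<close>, which by Markov's
  inequality for the potential has probability of order \<open>1 / A\<close>. The choice \<open>N = j\<^sup>4\<close> and \<open>A = j\<close>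
  makes both terms of order \<open>1 / j\<close>.
\<close>
lemma survive_bound:
  assumes x: "x \<in> closed_quadrant" and j: "0 < j"
  shows "prob (survive (real (j ^ 4))) \<le> (3 + 2 * log_potential 1 x) / real j"
proof -
  let ?N = "j ^ 4" and ?A = "real j"
  have N: "0 < real ?N" "sqrt (real ?N) = ?A * ?A"
    using j by (auto simp: real_sqrt_unique power4_eq_xxxx power2_eq_square)
  have [measurable]: "(fst :: real \<times> real \<Rightarrow> real) \<in> borel_measurable borel"
    by (intro borel_measurable_continuous_onI continuous_intros)
  let ?D = "\<lambda>\<omega>. B (0 + real ?N) \<omega> - B 0 \<omega>"
  let ?I = "{- fst x .. ?A - fst x} \<times> (UNIV :: real set)"
  define E1 where "E1 = ?D -` ?I \<inter> space M"
  define E2 where "E2 = {\<omega> \<in> space M. ?A < fst (stopped ?N \<omega>)}"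
  have I: "?I \<in> sets borel" by (intro borel_closed closed_Times) auto
  have D [measurable]: "?D \<in> borel_measurable M" by (intro borel_measurable_diff B_measurable) auto
  have E: "E1 \<in> sets M" "E2 \<in> sets M"
    using measurable_sets[OF D I] by (auto simp: E1_def E2_def)
  have lp: "0 \<le> log_potential 1 x" using log_potential_quadrant(1)[of 1 x] x by simp
  have "emeasure M E1 = emeasure (distr M borel ?D) ?I"
    unfolding E1_def by (rule emeasure_distr[symmetric]) (use D I in auto)
  also have "\<dots> \<le> ennreal ((?A - fst x - - fst x) / sqrt (real ?N))"
    unfolding B_increment_distr[OF order_refl N(1)] by (rule gaussian2_strip) (use N in auto)
  also have "\<dots> = ennreal (1 / ?A)" using j unfolding N(2) by simp
  finally have P1: "prob E1 \<le> 1 / ?A" by (simp add: emeasure_eq_measure)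
  have "emeasure M E2 = (\<integral>\<^sup>+\<omega>. indicator E2 \<omega> \<partial>M)" using E by simp
  also have "\<dots> \<le> (\<integral>\<^sup>+\<omega>. ennreal (2 / ?A) * (ennreal (log_potential 1 (stopped ?N \<omega>)) + 1) \<partial>M)"
  proof (intro nn_integral_mono)
    fix \<omega> assume \<omega>: "\<omega> \<in> space M"
    let ?l = "log_potential 1 (stopped ?N \<omega>)"
    note l = log_potential_quadrant[OF _ _ stopped_closed_quadrant[OF x \<omega>, of ?N], of 1]
    show "indicator E2 \<omega> \<le> ennreal (2 / ?A) * (ennreal ?l + 1)"
    proof (cases "\<omega> \<in> E2")
      case True
      then have "?A \<le> 2 * (?l + 1)" using l(2) by (simp add: E2_def)
      then have "1 \<le> (2 / ?A) * (?l + 1)" using j by (simp add: field_simps)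
      then have "ennreal 1 \<le> ennreal ((2 / ?A) * (?l + 1))" by (rule ennreal_leI)
      also have "\<dots> = ennreal (2 / ?A) * (ennreal ?l + 1)"
        using l(1) by (subst ennreal_mult) (auto simp: ennreal_plus)
      finally show ?thesis using True by simp
    qed simp
  qed
  also have "\<dots> = ennreal (2 / ?A) * ((\<integral>\<^sup>+\<omega>. ennreal (log_potential 1 (stopped ?N \<omega>)) \<partial>M) + 1)"
    by (simp add: nn_integral_cmult nn_integral_add emeasure_space_1)
  also have "\<dots> \<le> ennreal (2 / ?A) * (ennreal (log_potential 1 x) + 1)"
    using stopped_log_potential[of 1 ?N] x by (intro mult_left_mono add_right_mono) auto
  also have "\<dots> = ennreal ((2 / ?A) * (log_potential 1 x + 1))"
    using lp by (subst ennreal_mult) (auto simp: ennreal_plus)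
  finally have P2: "prob E2 \<le> (2 / ?A) * (log_potential 1 x + 1)"
    using lp by (simp add: emeasure_eq_measure)
  have "survive (real ?N) \<subseteq> E1 \<union> E2"
  proof
    fix \<omega> assume s: "\<omega> \<in> survive (real ?N)"
    then have \<omega>: "\<omega> \<in> space M" by (simp add: survive_def)
    have "stopped ?N \<omega> = B (real ?N) \<omega>" using s by (simp add: stopped_def)
    moreover have "0 \<le> fst (B (real ?N) \<omega>)"
      using survive_closed_quadrant[OF x s] by (auto simp: closed_quadrant_def)
    ultimately show "\<omega> \<in> E1 \<union> E2"
      using \<omega> B_start[OF \<omega>] by (cases "?A < fst (B (real ?N) \<omega>)") (auto simp: E1_def E2_def mem_Times_iff)
  qed
  then have "prob (survive (real ?N)) \<le> prob (E1 \<union> E2)"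
    using E by (intro finite_measure_mono) auto
  also have "\<dots> \<le> prob E1 + prob E2" using E by (intro measure_Un_le) auto
  also have "\<dots> \<le> 1 / ?A + (2 / ?A) * (log_potential 1 x + 1)" using P1 P2 by linarith
  also have "\<dots> = (3 + 2 * log_potential 1 x) / ?A"
    by (simp add: algebra_simps flip: add_divide_distrib)
  finally show ?thesis .
qed

lemma AE_exits:
  assumes x: "x \<in> closed_quadrant"
  shows "AE \<omega> in M. exits \<omega>"
proof -
  define E where "E = (\<Inter>j. survive (real (j ^ 4)))"
  have E: "E \<in> sets M" unfolding E_def by (intro sets.countable_INT survive_sets) auto
  have "prob E \<le> 0"
  proof (rule tendsto_lowerbound)
    show "(\<lambda>j. (3 + 2 * log_potential 1 x) / real j) \<longlonglongrightarrow> 0" by (rule lim_const_over_n)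
    show "\<forall>\<^sub>F j in sequentially. prob E \<le> (3 + 2 * log_potential 1 x) / real j"
      using eventually_gt_at_top[of 0]
    proof eventually_elim
      case (elim j)
      have "prob E \<le> prob (survive (real (j ^ 4)))"
        unfolding E_def by (intro finite_measure_mono survive_sets) auto
      then show ?case using survive_bound[OF x elim] by linarith
    qed
  qed simp
  then have "emeasure M E = 0" by (simp add: emeasure_eq_measure measure_le_0_iff)
  moreover have "{\<omega> \<in> space M. \<not> exits \<omega>} \<subseteq> E"
    using not_survive_iff by (auto simp: E_def)
  ultimately show ?thesis using E by (intro AE_I)
qed

text \<open>
  Superharmonicity in integrated form. The exit time is almost surely finite, so the stopped points
  are eventually equal to the exit point and Fatou's lemma applies once more.
\<close>
lemma exit_law_log_potential:
  assumes e: "0 < e" "e \<le> 1" and x: "x \<in> closed_quadrant"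
  shows "(\<integral>\<^sup>+z. ennreal (log_potential e z) \<partial>exit_law M B) \<le> ennreal (log_potential e x)"
proof (cases "(\<lambda>\<omega>. B (exit_time B \<omega>) \<omega>) \<in> borel_measurable M")
  case False
  then show ?thesis
    unfolding exit_law_def by (subst nn_integral_distr_nonmeasurable) (auto simp: emeasure_space_1)
next
  case True
  note True [measurable]
  let ?l = "\<lambda>z. ennreal (log_potential e z)"
  have "(\<integral>\<^sup>+z. ?l z \<partial>exit_law M B) = (\<integral>\<^sup>+\<omega>. ?l (B (exit_time B \<omega>) \<omega>) \<partial>M)"
    unfolding exit_law_def by (rule nn_integral_distr) measurable
  also have "\<dots> = (\<integral>\<^sup>+\<omega>. liminf (\<lambda>N. ?l (stopped N \<omega>)) \<partial>M)"
  proof (rule nn_integral_cong_AE)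
    show "AE \<omega> in M. ?l (B (exit_time B \<omega>) \<omega>) = liminf (\<lambda>N. ?l (stopped N \<omega>))"
      using AE_exits[OF x] AE_space
    proof eventually_elim
      case (elim \<omega>)
      obtain N0 where N0: "exit_time B \<omega> < real N0" using reals_Archimedean2 by blast
      have st: "stopped N \<omega> = B (exit_time B \<omega>) \<omega>" if "N0 \<le> N" for N
        using that N0 elim not_survive_iff[of \<omega> N] by (auto simp: stopped_def)
      then have "eventually (\<lambda>N. ?l (B (exit_time B \<omega>) \<omega>) = ?l (stopped N \<omega>)) sequentially"
        unfolding eventually_sequentially by (intro exI[of _ N0]) (simp add: st)
      then have "(\<lambda>N. ?l (stopped N \<omega>)) \<longlonglongrightarrow> ?l (B (exit_time B \<omega>) \<omega>)"
        using tendsto_cong by fastforce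
      then show ?case by (intro lim_imp_Liminf[symmetric]) auto
    qed
  qed
  also have "\<dots> \<le> liminf (\<lambda>N. \<integral>\<^sup>+\<omega>. ?l (stopped N \<omega>) \<partial>M)"
    by (rule nn_integral_liminf) measurable
  also have "\<dots> \<le> liminf (\<lambda>N. ?l x)"
    using stopped_log_potential[OF e x] by (intro Liminf_mono always_eventually) auto
  also have "\<dots> = ?l x" by (simp add: Liminf_const)
  finally show ?thesis .
qed

end

section \<open>A maximal inequality for Markov processes\<close>

lemma subalgebra_natural_filtration:
  assumes "\<And>u. 0 \<le> u \<Longrightarrow> X u \<in> borel_measurable M"
  shows "subalgebra M (natural_filtration M X s)"
proof -
  have "{X u -` A \<inter> space M | u A. 0 \<le> u \<and> u \<le> s \<and> A \<in> sets borel} \<subseteq> sets M"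
    using assms measurable_sets by blast
  then show ?thesis
    unfolding subalgebra_def natural_filtration_def
    by (simp add: space_measure_of_conv sets_measure_of_conv) (meson sets.sigma_sets_subset sets.space_closed order_trans)
qed

lemma sets_natural_filtration:
  "sets (natural_filtration M X s)
    = sigma_sets (space M) {X u -` A \<inter> space M | u A. 0 \<le> u \<and> u \<le> s \<and> A \<in> sets borel}"
  unfolding natural_filtration_def by (rule sets_measure_of) auto

lemma sets_natural_filtration_mono:
  "s \<le> t \<Longrightarrow> sets (natural_filtration M X s) \<subseteq> sets (natural_filtration M X t)"
proof -
  assume "s \<le> t"
  then have "u \<le> s \<Longrightarrow> u \<le> t" for u by simp
  then show ?thesis unfolding sets_natural_filtration by (intro sigma_sets_subseteq) blast
qed

lemma sets_natural_filtration_present: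
  "0 \<le> s \<Longrightarrow> A \<in> sets borel \<Longrightarrow> X s -` A \<inter> space M \<in> sets (natural_filtration M X s)"
  unfolding sets_natural_filtration by (intro sigma_sets.Basic) blast

lemma (in prob_space) nn_integral_real_cond_exp_indicator:
  assumes sub: "subalgebra M F" and A: "A \<in> sets F" and E: "E \<in> sets M"
  shows "emeasure M (E \<inter> A) = (\<integral>\<^sup>+\<omega>. ennreal (real_cond_exp M F (indicator E) \<omega>) * indicator A \<omega> \<partial>M)"
proof -
  interpret finite_measure_subalgebra M F
    using sub by unfold_locales
  let ?r = "real_cond_exp M F (indicator E)"
  have AM: "A \<in> sets M" using A sub by (auto simp: subalgebra_def)
  have intE: "integrable M (indicator E :: _ \<Rightarrow> real)" using E by (simp add: integrable_indicator_iff less_top[symmetric])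
  have r: "integrable M ?r" using intE by (rule real_cond_exp_int)
  have pos: "AE \<omega> in M. 0 \<le> ?r \<omega>"
    using E by (intro real_cond_exp_pos) auto
  have "(\<integral>\<omega>\<in>A. indicator E \<omega> \<partial>M) = (\<integral>\<omega>\<in>A. ?r \<omega> \<partial>M)"
    using intE A by (rule real_cond_exp_intA)
  moreover have "(\<integral>\<omega>\<in>A. indicator E \<omega> \<partial>M) = prob (E \<inter> A)"
    using E AM by (simp add: set_lebesgue_integral_def flip: indicator_inter_arith) (simp add: Int_commute)
  moreover have "(\<integral>\<^sup>+\<omega>. ennreal (?r \<omega>) * indicator A \<omega> \<partial>M) = (\<integral>\<^sup>+\<omega>. ennreal (indicator A \<omega> * ?r \<omega>) \<partial>M)"
    by (intro nn_integral_cong) (auto simp: indicator_def)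
  moreover have "\<dots> = ennreal (\<integral>\<omega>. indicator A \<omega> * ?r \<omega> \<partial>M)"
    using r AM pos integrable_mult_indicator[OF AM r]
    by (intro nn_integral_eq_integral) (auto elim!: eventually_mono)
  ultimately show ?thesis by (simp add: emeasure_eq_measure set_lebesgue_integral_def)
qed

text \<open>
  A function with \<open>\<integral> F dp\<^sub>t(y) \<le> u y\<close> satisfies the corresponding inequality for conditional
  expectations given the past of the process.
\<close>
lemma markov_nn_integral_le:
  fixes F u :: "real \<times> real \<Rightarrow> ennreal"
  assumes mp: "cadlag_markov_process S p x M X"
    and st: "0 \<le> s" "0 \<le> t" and A: "A \<in> sets (natural_filtration M X s)"
    and F [measurable]: "F \<in> borel_measurable borel" and u [measurable]: "u \<in> borel_measurable borel"
    and p: "\<And>y. y \<in> S \<Longrightarrow> sets (p t y) = sets borel"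
    and le: "\<And>y. y \<in> S \<Longrightarrow> (\<integral>\<^sup>+z. F z \<partial>p t y) \<le> u y"
  shows "(\<integral>\<^sup>+\<omega>. F (X (s + t) \<omega>) * indicator A \<omega> \<partial>M) \<le> (\<integral>\<^sup>+\<omega>. u (X s \<omega>) * indicator A \<omega> \<partial>M)"
proof -
  let ?N = "natural_filtration M X s"
  have X: "\<And>u. 0 \<le> u \<Longrightarrow> X u \<in> borel_measurable M"
    and XS: "\<And>\<omega>. \<omega> \<in> space M \<Longrightarrow> X s \<omega> \<in> S"
    and cond: "\<And>C. C \<in> sets borel \<Longrightarrow> AE \<omega> in M. real_cond_exp M ?N (\<lambda>\<omega>'. indicator C (X (s + t) \<omega>')) \<omega>
        = measure (p t (X s \<omega>)) C"
    using mp st unfolding cadlag_markov_process_def by auto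
  interpret prob_space M using mp by (simp add: cadlag_markov_process_def)
  have sub: "subalgebra M ?N" by (rule subalgebra_natural_filtration[OF X])
  have AM [measurable]: "A \<in> sets M" using A sub by (auto simp: subalgebra_def)
  have [measurable]: "X s \<in> borel_measurable M" "X (s + t) \<in> borel_measurable M" using X st by auto
  \<comment> \<open>The Markov property speaks of indicators, so it is lifted to simple functions below \<open>F\<close>.\<close>
  have simple: "(\<integral>\<^sup>+\<omega>. f (X (s + t) \<omega>) * indicator A \<omega> \<partial>M) \<le> (\<integral>\<^sup>+\<omega>. u (X s \<omega>) * indicator A \<omega> \<partial>M)"
    if f: "simple_function borel f" and fF: "\<And>z. f z \<le> F z" for f
  proof -
    define R where "R = f ` UNIV"
    define C where "C y = f -` {y}" for y
    define r where "r y = real_cond_exp M ?N (\<lambda>\<omega>'. indicator (C y) (X (s + t) \<omega>'))" for y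
    have R: "finite R" using f by (simp add: R_def simple_function_def)
    have C: "C y \<in> sets borel" for y
      using simple_functionD(2)[OF f, of "{y}"] unfolding C_def space_borel by (simp only: Int_UNIV_right)
    have rep: "f z = (\<Sum>y\<in>R. y * indicator (C y) z)" for z
      using simple_function_indicator_representation[OF f, of z]
      unfolding R_def C_def space_borel Int_UNIV_right by (simp only: UNIV_I)
    have [measurable]: "r y \<in> borel_measurable M" for y unfolding r_def by simp
    have AEr: "AE \<omega> in M. \<forall>y\<in>R. r y \<omega> = measure (p t (X s \<omega>)) (C y)"
      using R cond[OF C] by (simp add: r_def AE_finite_all)
    have CM: "(\<integral>\<^sup>+\<omega>. indicator (C y) (X (s + t) \<omega>) * indicator A \<omega> \<partial>M)
        = (\<integral>\<^sup>+\<omega>. ennreal (r y \<omega>) * indicator A \<omega> \<partial>M)" for y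
    proof -
      let ?E = "X (s + t) -` C y \<inter> space M"
      have E: "?E \<in> sets M" using C by measurable
      have "(\<integral>\<^sup>+\<omega>. indicator (C y) (X (s + t) \<omega>) * indicator A \<omega> \<partial>M) = (\<integral>\<^sup>+\<omega>. indicator (?E \<inter> A) \<omega> \<partial>M)"
        by (intro nn_integral_cong) (auto simp: indicator_def)
      also have "\<dots> = emeasure M (?E \<inter> A)" using E by simp
      also have "\<dots> = (\<integral>\<^sup>+\<omega>. ennreal (real_cond_exp M ?N (indicator ?E) \<omega>) * indicator A \<omega> \<partial>M)"
        using sub A E by (rule nn_integral_real_cond_exp_indicator)
      also have "\<dots> = (\<integral>\<^sup>+\<omega>. ennreal (r y \<omega>) * indicator A \<omega> \<partial>M)"
      proof (rule nn_integral_cong_AE)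
        interpret finite_measure_subalgebra M ?N using sub by unfold_locales
        have "AE \<omega> in M. real_cond_exp M ?N (indicator ?E) \<omega> = r y \<omega>"
          unfolding r_def using E C by (intro real_cond_exp_cong) (auto simp: indicator_def)
        then show "AE \<omega> in M. ennreal (real_cond_exp M ?N (indicator ?E) \<omega>) * indicator A \<omega>
            = ennreal (r y \<omega>) * indicator A \<omega>" by eventually_elim simp
      qed
      finally show ?thesis .
    qed
    have ind [measurable]: "(\<lambda>\<omega>. indicator (C y) (X (s + t) \<omega>) :: ennreal) \<in> borel_measurable M" for y
      using C by measurable
    have "(\<integral>\<^sup>+\<omega>. f (X (s + t) \<omega>) * indicator A \<omega> \<partial>M)
        = (\<integral>\<^sup>+\<omega>. (\<Sum>y\<in>R. y * (indicator (C y) (X (s + t) \<omega>) * indicator A \<omega>)) \<partial>M)"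
      by (simp add: rep sum_distrib_right mult.assoc)
    also have "\<dots> = (\<Sum>y\<in>R. y * (\<integral>\<^sup>+\<omega>. ennreal (r y \<omega>) * indicator A \<omega> \<partial>M))"
      by (simp add: nn_integral_sum nn_integral_cmult CM)
    also have "\<dots> = (\<integral>\<^sup>+\<omega>. (\<Sum>y\<in>R. y * ennreal (r y \<omega>)) * indicator A \<omega> \<partial>M)"
      by (simp add: nn_integral_sum nn_integral_cmult sum_distrib_right mult.assoc)
    also have "\<dots> \<le> (\<integral>\<^sup>+\<omega>. u (X s \<omega>) * indicator A \<omega> \<partial>M)"
    proof (rule nn_integral_mono_AE)
      show "AE \<omega> in M. (\<Sum>y\<in>R. y * ennreal (r y \<omega>)) * indicator A \<omega> \<le> u (X s \<omega>) * indicator A \<omega>"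
        using AEr AE_space
      proof eventually_elim
        case (elim \<omega>)
        let ?p = "p t (X s \<omega>)"
        have S: "X s \<omega> \<in> S" using elim XS by simp
        have sp: "space ?p = UNIV" using sets_eq_imp_space_eq[OF p[OF S]] by (simp only: space_borel)
        have "ennreal (enn2real a) \<le> a" for a by (cases a) auto
        then have "ennreal (r y \<omega>) \<le> emeasure ?p (C y)" if "y \<in> R" for y
          using elim that by (simp add: measure_def)
        then have "(\<Sum>y\<in>R. y * ennreal (r y \<omega>)) \<le> (\<Sum>y\<in>R. y * emeasure ?p (C y))"
          by (intro sum_mono mult_left_mono) auto
        also have "\<dots> = (\<integral>\<^sup>+z. f z \<partial>?p)"
        proof -
          have "simple_function ?p f"
            using f unfolding simple_function_def sp space_borel p[OF S] .
          then have "(\<integral>\<^sup>+z. f z \<partial>?p) = integral\<^sup>S ?p f" by (rule nn_integral_eq_simple_integral)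
          then show ?thesis by (simp add: simple_integral_def sp R_def C_def)
        qed
        also have "\<dots> \<le> (\<integral>\<^sup>+z. F z \<partial>?p)" using fF by (intro nn_integral_mono)
        also have "\<dots> \<le> u (X s \<omega>)" using le[OF S] .
        finally show ?case by (rule mult_right_mono) simp
      qed
    qed
    finally show ?thesis .
  qed
  obtain f where f: "\<And>i::nat. simple_function borel (f i)" "incseq f" "\<And>z. (SUP i. f i z) = F z"
    using borel_measurable_implies_simple_function_sequence'[OF F] by metis
  have fm [measurable]: "f i \<in> borel_measurable borel" for i
    using f(1) by (rule borel_measurable_simple_function)
  have "(\<integral>\<^sup>+\<omega>. F (X (s + t) \<omega>) * indicator A \<omega> \<partial>M)
      = (\<integral>\<^sup>+\<omega>. (SUP i. f i (X (s + t) \<omega>) * indicator A \<omega>) \<partial>M)"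
    by (simp add: SUP_mult_right_ennreal f(3)[symmetric])
  also have "\<dots> = (SUP i. \<integral>\<^sup>+\<omega>. f i (X (s + t) \<omega>) * indicator A \<omega> \<partial>M)"
  proof (rule nn_integral_monotone_convergence_SUP)
    show "incseq (\<lambda>i \<omega>. f i (X (s + t) \<omega>) * indicator A \<omega>)"
      unfolding incseq_def le_fun_def
      by (intro allI impI mult_right_mono le_funD[OF incseqD[OF f(2)]]) auto
  qed measurable
  also have "\<dots> \<le> (\<integral>\<^sup>+\<omega>. u (X s \<omega>) * indicator A \<omega> \<partial>M)"
    using f(1) by (intro SUP_least simple) (auto simp: f(3)[symmetric] intro: SUP_upper)
  finally show ?thesis .
qed

text \<open>
  Doob's maximal inequality for a nonnegative function that gains at most \<open>\<kappa>\<close> in mean per step. The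
  induction goes backwards in time: on the part \<open>A1\<close> of \<open>A\<close> where the level \<open>b\<close> is reached at once,
  the bound is Markov's inequality; the remaining part \<open>A2\<close> still belongs to the past, also to that
  of time \<open>s + d\<close>, so the induction hypothesis applies to \<open>A2\<close>. Allowing an arbitrary past event \<open>A\<close>
  is what makes the induction work.
\<close>
lemma markov_maximal_inequality:
  fixes f :: "real \<times> real \<Rightarrow> real"
  assumes mp: "cadlag_markov_process S p x M X"
    and d: "0 \<le> d" and \<kappa>: "0 \<le> \<kappa>"
    and f [measurable]: "f \<in> borel_measurable borel" and f0: "\<And>y. y \<in> S \<Longrightarrow> 0 \<le> f y"
    and p: "\<And>y. y \<in> S \<Longrightarrow> sets (p d y) = sets borel"
    and le: "\<And>y. y \<in> S \<Longrightarrow> (\<integral>\<^sup>+z. ennreal (f z) \<partial>p d y) \<le> ennreal (f y + \<kappa>)"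
    and s: "0 \<le> s" and A: "A \<in> sets (natural_filtration M X s)"
  shows "ennreal b * emeasure M (A \<inter> {\<omega> \<in> space M. \<exists>j\<le>n. b \<le> f (X (s + real j * d) \<omega>)})
    \<le> (\<integral>\<^sup>+\<omega>. (ennreal (f (X s \<omega>)) + ennreal (real n * \<kappa>)) * indicator A \<omega> \<partial>M)"
  using s A
proof (induction n arbitrary: s A)
  have X: "\<And>u. 0 \<le> u \<Longrightarrow> X u \<in> borel_measurable M"
    and XS: "\<And>\<omega> u. \<omega> \<in> space M \<Longrightarrow> 0 \<le> u \<Longrightarrow> X u \<omega> \<in> S"
    using mp unfolding cadlag_markov_process_def by auto
  have AM: "A \<in> sets M" if "A \<in> sets (natural_filtration M X s)" for A s
    using that subalgebra_natural_filtration[of X M s, OF X] by (auto simp: subalgebra_def)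
  have first: "ennreal b * emeasure M (A \<inter> {\<omega> \<in> space M. b \<le> f (X s \<omega>)})
      \<le> (\<integral>\<^sup>+\<omega>. ennreal (f (X s \<omega>)) * indicator (A \<inter> {\<omega> \<in> space M. b \<le> f (X s \<omega>)}) \<omega> \<partial>M)"
    if "0 \<le> s" "A \<in> sets M" for A s
  proof -
    have [measurable]: "X s \<in> borel_measurable M" "A \<in> sets M" using X that by auto
    let ?E = "A \<inter> {\<omega> \<in> space M. b \<le> f (X s \<omega>)}"
    have "ennreal b * emeasure M ?E = (\<integral>\<^sup>+\<omega>. ennreal b * indicator ?E \<omega> \<partial>M)"
      by (rule nn_integral_cmult_indicator[symmetric]) measurable
    also have "\<dots> \<le> (\<integral>\<^sup>+\<omega>. ennreal (f (X s \<omega>)) * indicator ?E \<omega> \<partial>M)"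
      by (intro nn_integral_mono) (auto simp: indicator_def ennreal_leI)
    finally show ?thesis .
  qed
  {
    case 0
    note [measurable] = X[OF 0(1)] AM[OF 0(2)]
    have "ennreal b * emeasure M (A \<inter> {\<omega> \<in> space M. b \<le> f (X s \<omega>)})
        \<le> (\<integral>\<^sup>+\<omega>. ennreal (f (X s \<omega>)) * indicator (A \<inter> {\<omega> \<in> space M. b \<le> f (X s \<omega>)}) \<omega> \<partial>M)"
      by (rule first) (use 0 AM in auto)
    also have "\<dots> \<le> (\<integral>\<^sup>+\<omega>. ennreal (f (X s \<omega>)) * indicator A \<omega> \<partial>M)"
      by (intro nn_integral_mono) (auto simp: indicator_def)
    finally show ?case by simp
  next
    case (Suc n)
    note s = \<open>0 \<le> s\<close> and A = \<open>A \<in> sets (natural_filtration M X s)\<close>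
    have [measurable]: "X s \<in> borel_measurable M" "X (s + d) \<in> borel_measurable M" "A \<in> sets M"
      using X s d AM[OF A] by auto
    have XM: "X (t + real j * d) \<in> borel_measurable M" if "0 \<le> t" for t j using X that d by auto
    let ?H = "\<lambda>n s. {\<omega> \<in> space M. \<exists>j\<le>n. b \<le> f (X (s + real j * d) \<omega>)}"
    have H: "?H n t \<in> sets M" if "0 \<le> t" for t n
      using XM[OF that] by measurable
    define A1 where "A1 = A \<inter> {\<omega> \<in> space M. b \<le> f (X s \<omega>)}"
    define A2 where "A2 = A - A1"
    have "A1 = A \<inter> (X s -` {y \<in> space borel. b \<le> f y} \<inter> space M)"
      using sets.sets_into_space[of A M] by (auto simp: A1_def)
    moreover have "X s -` {y \<in> space borel. b \<le> f y} \<inter> space M \<in> sets (natural_filtration M X s)"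
      by (rule sets_natural_filtration_present[OF s]) measurable
    ultimately have A1: "A1 \<in> sets (natural_filtration M X s)" using A by simp
    then have A2: "A2 \<in> sets (natural_filtration M X s)" using A by (simp add: A2_def)
    have A2': "A2 \<in> sets (natural_filtration M X (s + d))"
      using A2 sets_natural_filtration_mono[of s "s + d" M X] d by auto
    note [measurable] = AM[OF A1] AM[OF A2] H[OF s] H[of "s + d"]
    have sub: "A \<inter> ?H (Suc n) s \<subseteq> A1 \<union> (A2 \<inter> ?H n (s + d))"
    proof
      fix \<omega> assume "\<omega> \<in> A \<inter> ?H (Suc n) s"
      then obtain j where j: "\<omega> \<in> A" "\<omega> \<in> space M" "j \<le> Suc n" "b \<le> f (X (s + real j * d) \<omega>)" by auto
      show "\<omega> \<in> A1 \<union> (A2 \<inter> ?H n (s + d))"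
      proof (cases "\<omega> \<in> A1")
        case False
        then obtain i where i: "j = Suc i" using j by (cases j) (auto simp: A1_def)
        then have eq: "s + real j * d = s + d + real i * d" by (simp add: algebra_simps)
        have "b \<le> f (X (s + d + real i * d) \<omega>)" using j(4) unfolding eq .
        then show ?thesis using j i False by (auto simp: A2_def)
      qed simp
    qed
    have step: "(\<integral>\<^sup>+\<omega>. ennreal (f (X (s + d) \<omega>)) * indicator A2 \<omega> \<partial>M)
        \<le> (\<integral>\<^sup>+\<omega>. ennreal (f (X s \<omega>) + \<kappa>) * indicator A2 \<omega> \<partial>M)"
      by (rule markov_nn_integral_le[OF mp s d A2 _ _ p le]) measurable
    have "ennreal b * emeasure M (A \<inter> ?H (Suc n) s)
        \<le> ennreal b * (emeasure M A1 + emeasure M (A2 \<inter> ?H n (s + d)))"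
    proof (rule mult_left_mono)
      have sd: "0 \<le> s + d" using s d by simp
      have m: "A1 \<in> sets M" "A2 \<inter> ?H n (s + d) \<in> sets M"
        by (rule AM[OF A1], rule sets.Int[OF AM[OF A2] H[OF sd]])
      have "emeasure M (A \<inter> ?H (Suc n) s) \<le> emeasure M (A1 \<union> (A2 \<inter> ?H n (s + d)))"
        using m by (intro emeasure_mono sub sets.Un)
      also have "\<dots> \<le> emeasure M A1 + emeasure M (A2 \<inter> ?H n (s + d))"
        using m by (rule emeasure_subadditive)
      finally show "emeasure M (A \<inter> ?H (Suc n) s) \<le> emeasure M A1 + emeasure M (A2 \<inter> ?H n (s + d))" .
    qed simp
    also have "\<dots> = ennreal b * emeasure M A1 + ennreal b * emeasure M (A2 \<inter> ?H n (s + d))"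
      by (rule distrib_left)
    also have "\<dots> \<le> (\<integral>\<^sup>+\<omega>. ennreal (f (X s \<omega>)) * indicator A1 \<omega> \<partial>M)
        + (\<integral>\<^sup>+\<omega>. (ennreal (f (X (s + d) \<omega>)) + ennreal (real n * \<kappa>)) * indicator A2 \<omega> \<partial>M)"
      using first[OF s AM[OF A]] Suc.IH[OF _ A2'] s d by (intro add_mono) (auto simp: A1_def)
    also have "(\<integral>\<^sup>+\<omega>. (ennreal (f (X (s + d) \<omega>)) + ennreal (real n * \<kappa>)) * indicator A2 \<omega> \<partial>M)
        = (\<integral>\<^sup>+\<omega>. ennreal (f (X (s + d) \<omega>)) * indicator A2 \<omega> \<partial>M) + (\<integral>\<^sup>+\<omega>. ennreal (real n * \<kappa>) * indicator A2 \<omega> \<partial>M)"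
      unfolding distrib_right by (rule nn_integral_add) measurable
    also have "\<dots> \<le> (\<integral>\<^sup>+\<omega>. ennreal (f (X s \<omega>) + \<kappa>) * indicator A2 \<omega> \<partial>M) + (\<integral>\<^sup>+\<omega>. ennreal (real n * \<kappa>) * indicator A2 \<omega> \<partial>M)"
      by (rule add_right_mono[OF step])
    also have "(\<integral>\<^sup>+\<omega>. ennreal (f (X s \<omega>)) * indicator A1 \<omega> \<partial>M) + \<dots>
        = (\<integral>\<^sup>+\<omega>. ennreal (f (X s \<omega>)) * indicator A1 \<omega>
            + (ennreal (f (X s \<omega>) + \<kappa>) * indicator A2 \<omega> + ennreal (real n * \<kappa>) * indicator A2 \<omega>) \<partial>M)"
      by (simp add: nn_integral_add)
    also have "\<dots> \<le> (\<integral>\<^sup>+\<omega>. (ennreal (f (X s \<omega>)) + ennreal (real (Suc n) * \<kappa>)) * indicator A \<omega> \<partial>M)"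
    proof (intro nn_integral_mono)
      fix \<omega> assume \<omega>: "\<omega> \<in> space M"
      have "ennreal (f (X s \<omega>) + \<kappa>) + ennreal (real n * \<kappa>) = ennreal (f (X s \<omega>)) + ennreal (real (Suc n) * \<kappa>)"
        using f0[OF XS[OF \<omega> s]] \<kappa> by (simp add: algebra_simps flip: ennreal_plus)
      then show "ennreal (f (X s \<omega>)) * indicator A1 \<omega>
            + (ennreal (f (X s \<omega>) + \<kappa>) * indicator A2 \<omega> + ennreal (real n * \<kappa>) * indicator A2 \<omega>)
          \<le> (ennreal (f (X s \<omega>)) + ennreal (real (Suc n) * \<kappa>)) * indicator A \<omega>"
        by (cases "\<omega> \<in> A"; cases "\<omega> \<in> A1") (auto simp: A2_def A1_def)
    qed
    finally show ?case by (simp add: add_left_mono)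
  }
qed

text \<open>
  The deterministic motion towards \<open>\<theta>\<close> shrinks the modulus by at most the factor \<open>exp (- c d)\<close>,
  because both coordinates of \<open>\<theta>\<close> are nonnegative. The logarithm therefore gains at most \<open>c d\<close>.
\<close>
lemma log_potential_drift:
  assumes e: "0 < e" and c: "0 \<le> c" and d: "0 \<le> d"
    and \<theta>: "\<theta> \<in> closed_quadrant" and z: "z \<in> closed_quadrant"
  shows "log_potential e (exp (- (c * d)) *\<^sub>R z + (1 - exp (- (c * d))) *\<^sub>R \<theta>)
    \<le> log_potential e z + c * (1 + fst \<theta> + snd \<theta>) * d"
proof -
  define a where "a = exp (- (c * d))"
  have a: "0 < a" "a \<le> 1" "1 - a \<le> c * d"
    using c d exp_ge_add_one_self[of "- (c * d)"] by (auto simp: a_def)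
  define w where "w = a *\<^sub>R z + (1 - a) *\<^sub>R \<theta>"
  have n: "0 \<le> fst z" "0 \<le> snd z" "0 \<le> fst \<theta>" "0 \<le> snd \<theta>"
    using z \<theta> by (auto simp: closed_quadrant_def)
  have "(a * fst z)\<^sup>2 + (a * snd z)\<^sup>2 \<le> (fst w)\<^sup>2 + (snd w)\<^sup>2"
    using n a by (intro add_mono power_mono) (auto simp: w_def)
  then have "a\<^sup>2 * (norm z)\<^sup>2 \<le> (norm w)\<^sup>2"
    by (simp add: norm_prod_def power_mult_distrib distrib_left)
  moreover have "a\<^sup>2 * e \<le> 1 * e" using a e by (intro mult_right_mono power_le_one) auto
  ultimately have "a\<^sup>2 * ((norm z)\<^sup>2 + e) \<le> (norm w)\<^sup>2 + e" by (simp add: distrib_left)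
  moreover have p: "0 < (norm z)\<^sup>2 + e" "0 < (norm w)\<^sup>2 + e" using e by (auto intro: add_nonneg_pos)
  ultimately have "ln (a\<^sup>2 * ((norm z)\<^sup>2 + e)) \<le> ln ((norm w)\<^sup>2 + e)"
    using a by (subst ln_le_cancel_iff) auto
  moreover have "ln (a\<^sup>2 * ((norm z)\<^sup>2 + e)) = 2 * ln a + ln ((norm z)\<^sup>2 + e)"
    using a p by (simp add: ln_mult ln_realpow)
  moreover have "ln a = - (c * d)" by (simp add: a_def)
  moreover have "a * fst z \<le> fst z" "a * snd z \<le> snd z" using n a by (auto simp: mult_left_le_one_le)
  moreover have "(1 - a) * (fst \<theta> + snd \<theta>) \<le> c * d * (fst \<theta> + snd \<theta>)"
    using n a by (intro mult_right_mono) auto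
  ultimately have "log_potential e w \<le> log_potential e z + (c * d + c * d * (fst \<theta> + snd \<theta>))"
    by (simp add: log_potential_def w_def distrib_left)
  then show ?thesis by (simp add: w_def a_def algebra_simps)
qed

lemma log_potential_le:
  assumes "0 < e" "y \<noteq> 0"
  shows "log_potential e y \<le> fst y + snd y - ln (norm y)"
proof -
  have "0 < (norm y)\<^sup>2" "0 < (norm y)\<^sup>2 + e" using assms by (simp_all add: add_nonneg_pos)
  then have "ln ((norm y)\<^sup>2) \<le> ln ((norm y)\<^sup>2 + e)" using assms by (subst ln_le_cancel_iff) auto
  moreover have "ln ((norm y)\<^sup>2) = 2 * ln (norm y)" using assms by (simp add: ln_realpow)
  ultimately show ?thesis by (simp add: log_potential_def)
qed

section \<open>Polarity of the origin\<close>

lemma imcb_kernel_log_potential: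
  assumes c: "0 \<le> c" and \<theta>: "\<theta> \<in> closed_quadrant"
    and bm: "\<And>x. x \<in> closed_quadrant \<Longrightarrow> planar_brownian_motion (W x) (B x) x"
    and e: "0 < e" "e \<le> 1" and t: "0 \<le> t" and y: "y \<in> axes_E"
  defines "w \<equiv> exp (- (c * t)) *\<^sub>R y + (1 - exp (- (c * t))) *\<^sub>R \<theta>"
  shows "w \<in> closed_quadrant"
    and "(\<integral>\<^sup>+z. ennreal (log_potential e z) \<partial>imcb_kernel (\<lambda>x. exit_law (W x) (B x)) c \<theta> t y)
      \<le> ennreal (log_potential e w)"
proof -
  show w: "w \<in> closed_quadrant"
    using y \<theta> c t by (auto simp: w_def axes_E_def closed_quadrant_def)
  interpret planar_brownian "W w" "B w" w
    using bm[OF w] by (intro planar_brownian.intro planar_brownian_axioms.intro)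
      (auto simp: planar_brownian_motion_def)
  show "(\<integral>\<^sup>+z. ennreal (log_potential e z) \<partial>imcb_kernel (\<lambda>x. exit_law (W x) (B x)) c \<theta> t y)
      \<le> ennreal (log_potential e w)"
    using exit_law_log_potential[OF e w] by (simp add: imcb_kernel_def w_def)
qed

text \<open>
  For each \<open>k\<close> take the potential \<open>f k\<close> with regularisation \<open>exp (- 2 (k + 2))\<close>, whose value at the
  origin is \<open>k + 2\<close>. The mean of \<open>f k (X s)\<close> is bounded uniformly in \<open>k\<close>, because the law of
  \<open>X s\<close> is the exit law from a point \<open>y\<close> other than the origin. So the probability of the event \<open>G k\<close> of exceeding \<open>k + 1\<close> at
  some dyadic time after \<open>s\<close> is \<open>O(1 / k)\<close>. By right-continuity a visit to the origin forces such
  an excess for every \<open>k\<close> at once, and this has probability 0.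
\<close>
lemma imcb_never_hits_zero_after:
  fixes c :: real and \<theta> x :: "real \<times> real" and P M X
  assumes c: "0 \<le> c" and \<theta>: "\<theta> \<in> closed_quadrant"
    and bm: "\<And>x. x \<in> closed_quadrant \<Longrightarrow> planar_brownian_motion (W x) (B x) x"
    and mp: "cadlag_markov_process axes_E (imcb_kernel (\<lambda>x. exit_law (W x) (B x)) c \<theta>) x M X"
    and x: "x \<in> axes_E" and s: "0 < s"
    and y0: "exp (- (c * s)) *\<^sub>R x + (1 - exp (- (c * s))) *\<^sub>R \<theta> \<noteq> 0"
  shows "AE \<omega> in M. \<forall>t. s \<le> t \<and> t < s + real N \<longrightarrow> X t \<omega> \<noteq> 0"
proof -
  define y where "y = exp (- (c * s)) *\<^sub>R x + (1 - exp (- (c * s))) *\<^sub>R \<theta>"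
  define K where "K = c * (1 + fst \<theta> + snd \<theta>)"
  define L where "L = fst y + snd y - ln (norm y) + K * N"
  define f where "f k = log_potential (exp (- 2 * (real k + 2)))" for k :: nat
  define H where "H k m = {\<omega> \<in> space M. \<exists>j\<le>N * 2 ^ m. real (Suc k) \<le> f k (X (s + real j * (1 / 2 ^ m)) \<omega>)}"
    for k m :: nat
  let ?p = "imcb_kernel (\<lambda>x. exit_law (W x) (B x)) c \<theta>"
  have e: "0 < exp (- 2 * (real k + 2))" "exp (- 2 * (real k + 2)) \<le> 1" for k :: nat by auto
  have f_zero: "f k 0 = real k + 2" for k by (simp add: f_def log_potential_def field_simps)
  have [measurable]: "f k \<in> borel_measurable borel" for k unfolding f_def by simp
  have p: "sets (?p t z) = sets borel" for t z by (simp add: imcb_kernel_def exit_law_def)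
  have E: "z \<in> axes_E \<Longrightarrow> z \<in> closed_quadrant" for z by (simp add: axes_E_def)
  have K: "0 \<le> K" using \<theta> c by (auto simp: K_def closed_quadrant_def)
  interpret prob_space M using mp by (simp add: cadlag_markov_process_def)
  have X: "\<And>u. 0 \<le> u \<Longrightarrow> X u \<in> borel_measurable M"
    and XE: "\<And>\<omega> u. \<omega> \<in> space M \<Longrightarrow> 0 \<le> u \<Longrightarrow> X u \<omega> \<in> axes_E"
    and right: "\<And>\<omega> u. \<omega> \<in> space M \<Longrightarrow> 0 \<le> u \<Longrightarrow> ((\<lambda>t. X t \<omega>) \<longlongrightarrow> X u \<omega>) (at_right u)"
    and X0: "AE \<omega> in M. X 0 \<omega> = x"
    using mp unfolding cadlag_markov_process_def cadlag_def by auto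
  have [measurable]: "X s \<in> borel_measurable M" using X s by simp
  have HM: "H k m \<in> sets M" for k m
  proof -
    have [measurable]: "X (s + real j * (1 / 2 ^ m)) \<in> borel_measurable M" for j using X s by simp
    show ?thesis unfolding H_def by measurable
  qed
  have Hmono: "H k m \<subseteq> H k (Suc m)" for k m
  proof
    fix \<omega> assume "\<omega> \<in> H k m"
    then obtain j where j: "\<omega> \<in> space M" "j \<le> N * 2 ^ m"
      "real (Suc k) \<le> f k (X (s + real j * (1 / 2 ^ m)) \<omega>)" by (auto simp: H_def)
    have eq: "real (2 * j) * (1 / 2 ^ Suc m) = real j * (1 / 2 ^ m)" by simp
    have "real (Suc k) \<le> f k (X (s + real (2 * j) * (1 / 2 ^ Suc m)) \<omega>)"
      unfolding eq by (rule j(3))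
    moreover have "2 * j \<le> N * 2 ^ Suc m" using j(2) by simp
    ultimately show "\<omega> \<in> H k (Suc m)" unfolding H_def using j(1) by blast
  qed
  have start: "(\<integral>\<^sup>+\<omega>. ennreal (f k (X s \<omega>)) \<partial>M) \<le> ennreal (f k y)" for k
  proof -
    let ?u = "\<lambda>z. ennreal (f k (exp (- (c * s)) *\<^sub>R z + (1 - exp (- (c * s))) *\<^sub>R \<theta>))"
    have sp: "space M \<in> sets (natural_filtration M X 0)"
      using sets.top[of "natural_filtration M X 0"] by (simp add: natural_filtration_def space_measure_of_conv)
    have "(\<integral>\<^sup>+\<omega>. ennreal (f k (X (0 + s) \<omega>)) * indicator (space M) \<omega> \<partial>M)
        \<le> (\<integral>\<^sup>+\<omega>. ?u (X 0 \<omega>) * indicator (space M) \<omega> \<partial>M)"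
    proof (rule markov_nn_integral_le[OF mp order_refl less_imp_le[OF s] sp _ _ p])
      show "(\<integral>\<^sup>+z. ennreal (f k z) \<partial>?p s v) \<le> ?u v" if "v \<in> axes_E" for v
        unfolding f_def using imcb_kernel_log_potential(2)[OF c \<theta> bm e _ that] s by simp
    qed measurable
    also have "\<dots> = (\<integral>\<^sup>+\<omega>. ennreal (f k y) \<partial>M)"
    proof (rule nn_integral_cong_AE)
      show "AE \<omega> in M. ?u (X 0 \<omega>) * indicator (space M) \<omega> = ennreal (f k y)"
        using X0 AE_space by eventually_elim (simp add: y_def)
    qed
    also have "(\<integral>\<^sup>+\<omega>. ennreal (f k (X (0 + s) \<omega>)) * indicator (space M) \<omega> \<partial>M) = (\<integral>\<^sup>+\<omega>. ennreal (f k (X s \<omega>)) \<partial>M)"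
      by (intro nn_integral_cong) simp
    finally show ?thesis by (simp add: emeasure_space_1)
  qed
  have y: "y \<in> closed_quadrant" "y \<noteq> 0"
    using imcb_kernel_log_potential(1)[OF c \<theta> bm e(1,2)[of 0] _ x, of s] s y0 by (auto simp: y_def)
  have fy: "0 \<le> f k y" "f k y + K * N \<le> L" for k
    using log_potential_quadrant(1)[OF e y(1)] log_potential_le[OF e(1) y(2)] by (simp_all add: f_def L_def)
  have Hbound: "prob (H k m) \<le> L / real (Suc k)" for k m
  proof -
    let ?\<kappa> = "K * (1 / 2 ^ m)"
    have sp: "space M \<in> sets (natural_filtration M X s)"
      using sets.top[of "natural_filtration M X s"] by (simp add: natural_filtration_def space_measure_of_conv)
    have "ennreal (real (Suc k)) * emeasure M (space M \<inter> H k m)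
        \<le> (\<integral>\<^sup>+\<omega>. (ennreal (f k (X s \<omega>)) + ennreal (real (N * 2 ^ m) * ?\<kappa>)) * indicator (space M) \<omega> \<partial>M)"
      unfolding H_def
    proof (rule markov_maximal_inequality[OF mp _ _ _ _ p _ less_imp_le[OF s] sp])
      show "0 \<le> f k z" if "z \<in> axes_E" for z
        unfolding f_def using log_potential_quadrant(1)[OF e E[OF that]] .
      show "(\<integral>\<^sup>+v. ennreal (f k v) \<partial>?p (1 / 2 ^ m) z) \<le> ennreal (f k z + ?\<kappa>)" if "z \<in> axes_E" for z
      proof -
        have "(\<integral>\<^sup>+v. ennreal (f k v) \<partial>?p (1 / 2 ^ m) z)
            \<le> ennreal (f k (exp (- (c * (1 / 2 ^ m))) *\<^sub>R z + (1 - exp (- (c * (1 / 2 ^ m)))) *\<^sub>R \<theta>))"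
          unfolding f_def by (rule imcb_kernel_log_potential(2)[OF c \<theta> bm e _ that]) auto
        also have "\<dots> \<le> ennreal (f k z + ?\<kappa>)"
          unfolding f_def K_def by (intro ennreal_leI log_potential_drift[OF e(1) c _ \<theta> E[OF that]]) simp
        finally show ?thesis .
      qed
    qed (use K in auto)
    also have "\<dots> = (\<integral>\<^sup>+\<omega>. ennreal (f k (X s \<omega>)) + ennreal (K * N) \<partial>M)"
      by (intro nn_integral_cong) (simp add: mult_ac)
    also have "\<dots> = (\<integral>\<^sup>+\<omega>. ennreal (f k (X s \<omega>)) \<partial>M) + ennreal (K * N)"
      by (simp add: nn_integral_add emeasure_space_1)
    also have "\<dots> \<le> ennreal (f k y) + ennreal (K * N)" by (intro add_right_mono start)
    also have "\<dots> = ennreal (f k y + K * N)" using fy K by (simp add: ennreal_plus)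
    also have "\<dots> \<le> ennreal L" using fy by (intro ennreal_leI)
    finally have "ennreal (real (Suc k)) * emeasure M (H k m) \<le> ennreal L"
      using sets.sets_into_space[OF HM] by (simp add: Int_absorb1)
    moreover have "0 \<le> L" using fy[of k] K by (meson add_nonneg_nonneg mult_nonneg_nonneg of_nat_0_le_iff order_trans)
    ultimately have "real (Suc k) * prob (H k m) \<le> L"
      by (simp add: emeasure_eq_measure del: of_nat_Suc flip: ennreal_mult')
    then show ?thesis by (simp add: field_simps)
  qed
  define G where "G k = (\<Union>m. H k m)" for k
  have GM: "G k \<in> sets M" for k unfolding G_def using HM by blast
  have Gbound: "prob (G k) \<le> L / real (Suc k)" for k
  proof (rule tendsto_upperbound)
    show "(\<lambda>m. prob (H k m)) \<longlonglongrightarrow> prob (G k)"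
      unfolding G_def using HM Hmono by (intro finite_Lim_measure_incseq incseq_SucI) auto
  qed (use Hbound in auto)
  have hit: "\<omega> \<in> G k" if \<omega>: "\<omega> \<in> space M" and t: "s \<le> t" "t < s + real N" "X t \<omega> = 0" for \<omega> t k
  proof -
    define q where "q m = s + real (dyadic_right (t - s) m) * (1 / 2 ^ m)" for m
    have ts: "0 \<le> t - s" using t by simp
    have "q \<longlonglongrightarrow> s + (t - s)"
      unfolding q_def using dyadic_right_tendsto[OF ts] by (intro tendsto_intros) simp
    then have q: "q \<longlonglongrightarrow> t" by simp
    have gt: "t < q m" for m using dyadic_right_bounds(1)[OF ts, of m] by (simp add: q_def)
    then have lim: "filterlim q (at_right t) sequentially"
      using q by (auto simp: filterlim_at intro!: always_eventually less_imp_neq[symmetric])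
    have "0 \<le> t" using t s by simp
    then have "(\<lambda>m. X (q m) \<omega>) \<longlonglongrightarrow> X t \<omega>"
      by (rule filterlim_compose[OF right[OF \<omega>] lim])
    then have "(\<lambda>m. f k (X (q m) \<omega>)) \<longlonglongrightarrow> f k (X t \<omega>)"
      unfolding f_def by (intro continuous_on_tendsto_compose[OF continuous_on_log_potential[OF e(1)]]) auto
    moreover have "real (Suc k) < f k (X t \<omega>)" using t f_zero by simp
    ultimately have "eventually (\<lambda>m. real (Suc k) < f k (X (q m) \<omega>)) sequentially"
      by (rule order_tendstoD(1))
    moreover have "eventually (\<lambda>m. q m < s + real N) sequentially"
      using q t(2) by (rule order_tendstoD(2))
    ultimately have "eventually (\<lambda>m. real (Suc k) < f k (X (q m) \<omega>) \<and> q m < s + real N) sequentially"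
      by (rule eventually_conj)
    then obtain m where m: "real (Suc k) < f k (X (q m) \<omega>)" "q m < s + real N"
      by (auto simp: eventually_sequentially)
    have "real (dyadic_right (t - s) m) < real N * 2 ^ m" using m(2) by (simp add: q_def field_simps)
    also have "\<dots> = real (N * 2 ^ m)" by simp
    finally have "dyadic_right (t - s) m \<le> N * 2 ^ m" by linarith
    then have "\<omega> \<in> H k m" unfolding H_def using \<omega> m(1)
      by (auto simp: q_def intro!: exI[of _ "dyadic_right (t - s) m"])
    then show ?thesis by (auto simp: G_def)
  qed
  define Z where "Z = (\<Inter>k. G k)"
  have ZM: "Z \<in> sets M" unfolding Z_def using GM by blast
  have "prob Z \<le> 0"
  proof (rule tendsto_lowerbound)
    show "(\<lambda>k. L / real (Suc k)) \<longlonglongrightarrow> 0" by (rule LIMSEQ_Suc[OF lim_const_over_n])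
    have "prob Z \<le> L / real (Suc k)" for k
    proof -
      have "prob Z \<le> prob (G k)" unfolding Z_def by (intro finite_measure_mono GM) auto
      then show ?thesis using Gbound[of k] by linarith
    qed
    then show "\<forall>\<^sub>F k in sequentially. prob Z \<le> L / real (Suc k)" by simp
  qed simp
  then have "emeasure M Z = 0" by (simp add: emeasure_eq_measure measure_le_0_iff)
  moreover have "{\<omega> \<in> space M. \<not> (\<forall>t. s \<le> t \<and> t < s + real N \<longrightarrow> X t \<omega> \<noteq> 0)} \<subseteq> Z"
    using hit by (auto simp: Z_def)
  ultimately show ?thesis using ZM by (intro AE_I)
qed

text \<open>
  A convex combination of points of the quadrant vanishes only if each point with positive weight
  does. So for every \<open>s > 0\<close> the law of \<open>X s\<close> is the exit law from a point other than the origin, and countably many time windows cover all positive times.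
\<close>
lemma imcb_never_hits_zero:
  assumes c: "0 \<le> c" and \<theta>: "\<theta> \<in> closed_quadrant"
    and bm: "\<And>x. x \<in> closed_quadrant \<Longrightarrow> planar_brownian_motion (W x) (B x) x"
    and mp: "cadlag_markov_process axes_E (imcb_kernel (\<lambda>x. exit_law (W x) (B x)) c \<theta>) x M X"
    and x: "x \<in> axes_E" and nz: "x \<noteq> 0 \<or> (0 < c \<and> \<theta> \<noteq> 0)"
  shows "never_hits M X {0}"
proof -
  have ne: "exp (- (c * s)) *\<^sub>R x + (1 - exp (- (c * s))) *\<^sub>R \<theta> \<noteq> 0" if s: "0 < s" for s
  proof
    assume eq: "exp (- (c * s)) *\<^sub>R x + (1 - exp (- (c * s))) *\<^sub>R \<theta> = 0"
    let ?a = "exp (- (c * s))"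
    have a: "0 < ?a" "0 \<le> 1 - ?a" using c s by auto
    have n: "0 \<le> fst x" "0 \<le> snd x" "0 \<le> fst \<theta>" "0 \<le> snd \<theta>"
      using x \<theta> by (auto simp: axes_E_def closed_quadrant_def)
    have "?a * fst x + (1 - ?a) * fst \<theta> = 0" "?a * snd x + (1 - ?a) * snd \<theta> = 0"
      using arg_cong[OF eq, of fst] arg_cong[OF eq, of snd] by auto
    then have z: "?a * fst x = 0" "(1 - ?a) * fst \<theta> = 0" "?a * snd x = 0" "(1 - ?a) * snd \<theta> = 0"
      using a n by (smt (verit) mult_nonneg_nonneg)+
    then have "x = 0" by (simp add: prod_eq_iff)
    then have "0 < c" "\<theta> \<noteq> 0" using nz by auto
    then have "1 - ?a \<noteq> 0" using s by simp
    then have "\<theta> = 0" using z by (simp add: prod_eq_iff)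
    then show False using \<open>\<theta> \<noteq> 0\<close> by simp
  qed
  have "AE \<omega> in M. \<forall>k N. \<forall>t. 1 / real (Suc k) \<le> t \<and> t < 1 / real (Suc k) + real N \<longrightarrow> X t \<omega> \<noteq> 0"
    unfolding AE_all_countable
    by (intro allI imcb_never_hits_zero_after[OF c \<theta> bm mp x] ne) auto
  then show ?thesis unfolding never_hits_def
  proof eventually_elim
    case (elim \<omega>)
    show ?case
    proof
      assume "\<exists>t>0. X t \<omega> \<in> {0}"
      then obtain t where t: "0 < t" "X t \<omega> = 0" by auto
      obtain k where "inverse (real (Suc k)) < t" using reals_Archimedean[OF t(1)] by blast
      then have k: "1 / real (Suc k) \<le> t" by (simp add: inverse_eq_divide)
      obtain N where "t < real N" using reals_Archimedean2 by blast
      moreover have "0 < 1 / real (Suc k)" by simp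
      ultimately have "t < 1 / real (Suc k) + real N" by linarith
      then show False using elim k t by blast
    qed
  qed
qed

theorem theorem1p7:
  fixes c :: real and \<theta> :: "real \<times> real"
    and W :: "real \<times> real \<Rightarrow> 'v measure"
    and B :: "real \<times> real \<Rightarrow> real \<Rightarrow> 'v \<Rightarrow> real \<times> real"
    and P :: "real \<times> real \<Rightarrow> 'w measure"
    and X :: "real \<Rightarrow> 'w \<Rightarrow> real \<times> real"
  assumes "c \<ge> 0"
    and "\<theta> \<in> closed_quadrant"
    and "\<And>x. x \<in> closed_quadrant \<Longrightarrow> planar_brownian_motion (W x) (B x) x"
    and "imcb_process (\<lambda>x. exit_law (W x) (B x)) c \<theta> P X"
  shows "(c > 0 \<and> \<theta> \<noteq> 0 \<longrightarrow> polar P X {0}) \<and>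
         (\<forall>x\<in>axes_E. x \<noteq> 0 \<longrightarrow> never_hits (P x) X {0})"
proof -
  have hits: "never_hits (P x) X {0}" if "x \<in> axes_E" "x \<noteq> 0 \<or> (0 < c \<and> \<theta> \<noteq> 0)" for x
    using imcb_never_hits_zero[OF assms(1,2,3) _ that] assms(4) that(1)
    by (auto simp: imcb_process_def)
  have "{0} \<subseteq> axes_E" by (auto simp: axes_E_def closed_quadrant_def open_quadrant_def zero_prod_def)
  then show ?thesis using hits by (auto simp: polar_def)
qed

end
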